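(* Let $(a_n)_{n\ge1}$ be a sequence of complex numbers such that the Dirichlet series $D(s)=\sum_{n\ge1}a_n n^{-s}$ (with $s=\sigma+\mathrm{i}\tau$) converges absolutely for $\Re(s)>1$ and has an analytic continuation to the set $\Omega=\{s=\sigma+\mathrm{i}\tau:\ \sigma\ge g(\tau)\}$, where $$g(\tau)=\begin{cases}1-b(\log|\tau|)^{-\alpha}(\log\log|\tau|)^{-\beta}, & |\tau|\ge w,\\ 1-b(\log w)^{-\alpha}(\log\log w)^{-\beta}, & |\tau|\le w,\end{cases}$$ for some positive parameters $\alpha,\beta,b,w$. Assume furthermore that $D(s)=\mathrm{O}(|\tau|^{\nu})$ uniformly as $s\to\infty$ in $\Omega$, for some $\nu>0$. Then for every $\varepsilon>0$, $$\sum_{n=1}^\infty a_n z^n=\mathrm{O}\!\left(\frac{1}{|t|}\exp\!\left(-\frac{(b-\varepsilon)\log(1/|t|)}{(\log\log(1/|t|))^{\alpha}(\log\log\log(1/|t|))^{\beta}}\right)\right),\qquad t=-\log z,$$ as $z\to1$ within any sector $S_\theta=\{z\in\mathbb{C}:|\arg(1-z)|\le\tfrac12\pi-\theta\}$ with $\theta>0$ (note $t\sim 1-z$).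
   Context: Here $\log$ denotes the principal branch, so $t=-\log z\to0$ as $z\to1$. *)

theory Defs
  imports "HOL-Analysis.Analysis"
begin

definition gfun :: "real \<Rightarrow> real \<Rightarrow> real \<Rightarrow> real \<Rightarrow> real \<Rightarrow> real" where
  "gfun \<alpha> \<beta> b w \<tau> =
     (if \<bar>\<tau>\<bar> \<ge> w
      then 1 - b * (ln \<bar>\<tau>\<bar>) powr (-\<alpha>) * (ln (ln \<bar>\<tau>\<bar>)) powr (-\<beta>)
      else 1 - b * (ln w) powr (-\<alpha>) * (ln (ln w)) powr (-\<beta>))"

definition Omega :: "real \<Rightarrow> real \<Rightarrow> real \<Rightarrow> real \<Rightarrow> complex set" where
  "Omega \<alpha> \<beta> b w = {s. Re s \<ge> gfun \<alpha> \<beta> b w (Im s)}"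

definition sector :: "real \<Rightarrow> complex set" where
  "sector \<theta> = {z. \<bar>Arg (1 - z)\<bar> \<le> pi / 2 - \<theta>}"

definition dirichlet_series :: "(nat \<Rightarrow> complex) \<Rightarrow> complex \<Rightarrow> complex" where
  "dirichlet_series a s = (\<Sum>n. a (Suc n) * of_nat (Suc n) powr (- s))"

definition power_ser :: "(nat \<Rightarrow> complex) \<Rightarrow> complex \<Rightarrow> complex" where
  "power_ser a z = (\<Sum>n. a (Suc n) * z ^ Suc n)"

end

theory Submission
  imports Defs "HOL-Complex_Analysis.Complex_Analysis" "HOL-Real_Asymp.Real_Asymp"
begin

text \<open>
  With \<open>t = - Ln z\<close>, the Cahen--Mellin formula represents \<open>2 \<pi> \<Sum>a\<^sub>n exp (- n t)\<close> as the integral of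
  \<open>D(s) \<Gamma>(s) t powr (- s)\<close> over the line \<open>Re s = 2\<close>. Since \<open>\<bar>arg t\<bar>\<close> stays away from \<open>\<pi>/2\<close>, the kernel
  \<open>\<Gamma>(s) t powr (- s)\<close> decays like \<open>exp (- \<delta> \<bar>Im s\<bar>)\<close>, so cutting the line off at height
  \<open>L = K log (1/\<bar>t\<bar>)\<close> with \<open>K\<close> large costs only \<open>O(1)\<close>. Because \<open>g\<close> increases with \<open>\<bar>\<tau>\<bar>\<close>, the whole
  rectangle \<open>[g(L), 2] \<times> [-L, L]\<close> lies in \<open>\<Omega>\<close>, and Cauchy's theorem on it moves the integral to the line
  \<open>Re s = g(L)\<close>, where it is \<open>O(\<bar>t\<bar> powr (- g(L)))\<close>; no integration along the curved boundary of
  \<open>\<Omega>\<close> is needed. Finally \<open>log L \<sim> log log (1/\<bar>t\<bar>)\<close>.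
\<close>

section \<open>Decay of the Gamma function on vertical lines\<close>

text \<open>In the Euler product for \<open>\<bar>\<Gamma>(\<sigma> + i\<tau>)\<bar> / \<Gamma>(\<sigma>)\<close> each factor \<open>(\<sigma> + k) / \<bar>\<sigma> + k + i\<tau>\<bar>\<close> increases
  with \<open>\<sigma>\<close>; this replaces Stirling's formula, as the case \<open>\<sigma> = 1\<close> is explicit by reflection.\<close>

lemma norm_Gamma_div_Gamma_Re_mono:
  fixes s :: complex
  assumes "0 < Re s" "Re s \<le> c"
  shows "norm (Gamma s) * Gamma c \<le> Gamma (Re s) * norm (Gamma (Complex c (Im s)))"
proof -
  define \<sigma> \<tau> where "\<sigma> = Re s" and "\<tau> = Im s"
  have pos: "0 < \<sigma>" "\<sigma> \<le> c" using assms by (auto simp: \<sigma>_def)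
  have norm_poch: "norm (pochhammer (Complex x \<tau>) m) = (\<Prod>k<m. norm (Complex (x + real k) \<tau>))" for x m
    unfolding pochhammer_prod lessThan_atLeast0 prod_norm [symmetric]
    by (intro prod.cong refl arg_cong[of _ _ norm]) (simp add: complex_eq_iff)
  have ineq: "norm (Gamma_series (Complex \<sigma> \<tau>) n) * Gamma_series c n
              \<le> Gamma_series \<sigma> n * norm (Gamma_series (Complex c \<tau>) n)" for n
  proof -
    have "(\<Prod>k<n+1. (\<sigma> + real k) * norm (Complex (c + real k) \<tau>)) \<le> (\<Prod>k<n+1. norm (Complex (\<sigma> + real k) \<tau>) * (c + real k))"
    proof (intro prod_mono conjI)
      fix k :: nat
      \<comment> \<open>After squaring, the products
        \<open>(\<sigma> + k)\<^sup>2 * (c + k)\<^sup>2\<close> on the two sides cancel, and only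
        the comparison of the \<open>\<tau>\<^sup>2\<close> terms is left.\<close>
      have "(\<sigma> + k)\<^sup>2 \<le> (c + k)\<^sup>2"
        using pos by (intro power_mono) auto
      hence "(\<sigma> + k)\<^sup>2 * \<tau>\<^sup>2 \<le> (c + k)\<^sup>2 * \<tau>\<^sup>2"
        by (intro mult_right_mono) auto
      hence "((\<sigma> + k) * norm (Complex (c + k) \<tau>))\<^sup>2 \<le> (norm (Complex (\<sigma> + k) \<tau>) * (c + k))\<^sup>2"
        unfolding power_mult_distrib cmod_power2 by (simp add: distrib_left distrib_right mult.commute[of "\<tau>\<^sup>2"])
      thus "(\<sigma> + k) * norm (Complex (c + k) \<tau>) \<le> norm (Complex (\<sigma> + k) \<tau>) * (c + k)"
        by (rule power2_le_imp_le) (use pos in auto)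
    qed (use pos in auto)
    hence "pochhammer \<sigma> (n+1) * norm (pochhammer (Complex c \<tau>) (n+1))
           \<le> norm (pochhammer (Complex \<sigma> \<tau>) (n+1)) * pochhammer c (n+1)"
      unfolding norm_poch by (simp only: pochhammer_prod lessThan_atLeast0 prod.distrib of_nat_id)
    moreover have "pochhammer \<sigma> (n+1) > 0" "pochhammer c (n+1) > 0"
      using pos by (auto intro!: pochhammer_pos)
    moreover have "norm (pochhammer (Complex x \<tau>) (n+1)) > 0" if "x > 0" for x
      unfolding norm_poch using that by (intro prod_pos) (auto simp: complex_eq_iff)
    ultimately have "A / (norm (pochhammer (Complex \<sigma> \<tau>) (n+1)) * pochhammer c (n+1))
        \<le> A / (pochhammer \<sigma> (n+1) * norm (pochhammer (Complex c \<tau>) (n+1)))" if "A \<ge> 0" for A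
      using pos that by (intro divide_left_mono mult_pos_pos) auto
    \<comment> \<open>Since \<open>n powr (\<i> * \<tau>)\<close> has modulus 1, the numerators of
      the Gamma series have the same product on both sides, so comparing the Pochhammer denominators
      suffices.\<close>
    from this[of "fact n * exp (\<sigma> * ln (real n)) * (fact n * exp (c * ln (real n)))"] show ?thesis
      by (simp only: Gamma_series_def norm_divide norm_mult norm_fact norm_exp_eq_Re
            times_divide_times_eq) simp
  qed
  have "norm (Gamma (Complex \<sigma> \<tau>)) * Gamma c \<le> Gamma \<sigma> * norm (Gamma (Complex c \<tau>))"
  proof (rule LIMSEQ_le)
    show "(\<lambda>n. norm (Gamma_series (Complex \<sigma> \<tau>) n) * Gamma_series c n)
            \<longlonglongrightarrow> norm (Gamma (Complex \<sigma> \<tau>)) * Gamma c"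
      by (intro tendsto_intros Gamma_series_LIMSEQ)
    show "(\<lambda>n. Gamma_series \<sigma> n * norm (Gamma_series (Complex c \<tau>) n))
            \<longlonglongrightarrow> Gamma \<sigma> * norm (Gamma (Complex c \<tau>))"
      by (intro tendsto_intros Gamma_series_LIMSEQ)
  qed (use ineq in blast)
  thus ?thesis by (simp add: \<sigma>_def \<tau>_def)
qed

text \<open>Writing one factor as \<open>\<i> * y * Gamma (\<i> * y)\<close> and conjugating the
  other, the reflection formula gives the exact value \<open>x / sinh x\<close> with
  \<open>x = pi * \<bar>y\<bar>\<close>. The stated bound is a form of it that extends to
  \<open>y = 0\<close> and shows the exponential rate.\<close>

lemma norm_Gamma_1_plus_imaginary:
  "(norm (Gamma (Complex 1 y)))\<^sup>2 \<le> (1 + 2 * pi * \<bar>y\<bar>) * exp (- pi * \<bar>y\<bar>)"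
proof (cases "y = 0")
  case True
  thus ?thesis by (simp add: Complex_eq)
next
  case False
  define x where "x = pi * \<bar>y\<bar>"
  have "x > 0" using False by (simp add: x_def)
  have "\<i> * y \<notin> \<int>\<^sub>\<le>\<^sub>0" using False by (auto elim!: nonpos_Ints_cases simp: complex_eq_iff)
  hence plus1: "Gamma (Complex 1 y) = \<i> * y * Gamma (\<i> * y)"
    using Gamma_plus1[of "\<i> * y"] by (simp add: Complex_eq add.commute)
  have "cnj (Gamma (Complex 1 y)) = Gamma (1 - \<i> * y)"
    by (simp add: Complex_eq cnj_Gamma)
  hence conj: "norm (Gamma (1 - \<i> * y)) = norm (Gamma (Complex 1 y))"
    by (metis complex_mod_cnj)
  have sin: "sin (of_real pi * (\<i> * y)) = \<i> * of_real (sinh (pi * y))"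
    using sin_i_times[of "of_real (pi * y)"]
    by (simp add: sinh_field_def exp_minus mult_ac flip: exp_of_real)
  have "(norm (Gamma (Complex 1 y)))\<^sup>2 = norm (\<i> * y * Gamma (\<i> * y)) * norm (Gamma (1 - \<i> * y))"
    unfolding conj plus1 [symmetric] by (simp add: power2_eq_square)
  also have "\<dots> = norm (\<i> * y * (Gamma (\<i> * y) * Gamma (1 - \<i> * y)))"
    by (simp only: norm_mult mult.assoc)
  also have "\<dots> = norm (\<i> * y * (of_real pi / (\<i> * of_real (sinh (pi * y)))))"
    unfolding Gamma_reflection_complex sin ..
  also have "\<dots> = x / sinh x"
    by (simp add: norm_mult norm_divide x_def abs_mult flip: sinh_real_abs)
  also have "\<dots> \<le> (1 + 2 * x) * exp (-x)"
  proof -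
    \<comment> \<open>With \<open>q = exp x\<close> and \<open>sinh x = (q - 1/q) / 2\<close>, the
      claim rearranges to \<open>1 + 2 * x \<le> q * q\<close>.\<close>
    define q where "q = exp x"
    have "1 + 2 * x \<le> q * q"
      using exp_ge_add_one_self[of "2*x"] by (simp add: q_def flip: exp_add)
    moreover have "q > 1" using \<open>x > 0\<close> by (simp add: q_def)
    ultimately have "x \<le> (1 + 2 * x) * (1 / q) * ((q - 1 / q) / 2)" "q - 1 / q > 0"
      by (simp_all add: field_simps less_1_mult)
    hence "x / ((q - 1 / q) / 2) \<le> (1 + 2 * x) * (1 / q)"
      by (subst pos_divide_le_eq) auto
    thus ?thesis by (simp add: sinh_field_def q_def exp_minus inverse_eq_divide)
  qed
  finally show ?thesis by (simp add: x_def mult.assoc)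
qed

text \<open>Lets a linear factor be absorbed into an exponential of arbitrarily small rate
  \<open>d\<close>, at the price of a constant.\<close>

lemma one_plus_le_exp: "d > 0 \<Longrightarrow> u \<ge> 0 \<Longrightarrow> 1 + u \<le> (1 + 1 / d) * exp (d * u)" for d u :: real
proof -
  assume d: "d > 0" "u \<ge> 0"
  have "1 + u \<le> (1 + 1 / d) * (1 + d * u)" using d by (simp add: field_simps)
  also have "\<dots> \<le> (1 + 1 / d) * exp (d * u)"
    using d exp_ge_add_one_self[of "d * u"] by (intro mult_left_mono) (auto simp: add.commute)
  finally show ?thesis .
qed

text \<open>The explicit bound at \<open>Re s = 1\<close> passes to \<open>Re s = 2\<close> by the
  functional equation, and from there to the whole strip by the monotonicity lemma with
  \<open>c = 2\<close>, where \<open>Gamma 2 = 1\<close>; the real factor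
  \<open>Gamma (Re s)\<close> is bounded by compactness. The linear factors picked up on the way use
  up the slack \<open>\<delta>\<close>.\<close>

lemma norm_Gamma_strip_bound:
  assumes "\<delta> > 0"
  shows "\<exists>C>0. \<forall>s. 1/2 \<le> Re s \<longrightarrow> Re s \<le> 2 \<longrightarrow> norm (Gamma s) \<le> C * exp (- (pi / 2 - \<delta>) * \<bar>Im s\<bar>)"
proof -
  have "continuous_on {1/2..2::real} Gamma"
    by (intro continuous_on_Gamma continuous_intros) (auto elim!: nonpos_Ints_cases)
  then obtain x where x: "\<forall>y\<in>{1/2..2}. Gamma y \<le> Gamma (x::real)"
    using continuous_attains_sup[of "{1/2..2::real}" Gamma] by auto
  define G where "G = Gamma x"
  have G: "\<And>y. y \<in> {1/2..2} \<Longrightarrow> Gamma y \<le> G" using x by (simp add: G_def)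
  have "G > 0" using G[of 1] by simp
  \<comment> \<open>Absorbing \<open>1 + \<bar>y\<bar>\<close> and
    \<open>1 + 2 * pi * \<bar>y\<bar>\<close> costs the rates \<open>2 * d\<close> and
    \<open>2 * pi * d\<close>, which must add up to \<open>\<delta>\<close>.\<close>
  define d where "d = \<delta> / (2 + 2 * pi)"
  have "d > 0" using assms by (simp add: d_def add_pos_pos)
  define K where "K = 1 + 1 / d"
  have "K > 0" using \<open>d > 0\<close> by (simp add: K_def add_pos_pos)
  show ?thesis
  proof (intro exI[of _ "G * K * K"] conjI allI impI)
    show "G * K * K > 0" using \<open>G > 0\<close> \<open>K > 0\<close> by simp
    fix s :: complex assume s: "1/2 \<le> Re s" "Re s \<le> 2"
    define y where "y = Im s"
    have "norm (Gamma (Complex 1 y)) \<le> (1 + 2 * pi * \<bar>y\<bar>) * exp (- pi / 2 * \<bar>y\<bar>)"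
    proof (rule power2_le_imp_le)
      have "1 + 2 * pi * \<bar>y\<bar> \<le> (1 + 2 * pi * \<bar>y\<bar>)\<^sup>2" by (simp add: power2_eq_square algebra_simps)
      hence "(1 + 2 * pi * \<bar>y\<bar>) * exp (- pi * \<bar>y\<bar>) \<le> (1 + 2 * pi * \<bar>y\<bar>)\<^sup>2 * exp (- pi * \<bar>y\<bar>)"
        by (intro mult_right_mono) auto
      also have "\<dots> = ((1 + 2 * pi * \<bar>y\<bar>) * exp (- pi / 2 * \<bar>y\<bar>))\<^sup>2"
        by (simp add: power_mult_distrib flip: exp_double)
      finally show "(norm (Gamma (Complex 1 y)))\<^sup>2 \<le> ((1 + 2 * pi * \<bar>y\<bar>) * exp (- pi / 2 * \<bar>y\<bar>))\<^sup>2"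
        using norm_Gamma_1_plus_imaginary[of y] by linarith
    qed auto
    also have "\<dots> \<le> (K * exp (d * (2 * pi * \<bar>y\<bar>))) * exp (- pi / 2 * \<bar>y\<bar>)"
      unfolding K_def using \<open>d > 0\<close> by (intro mult_right_mono one_plus_le_exp) auto
    finally have 1: "norm (Gamma (Complex 1 y)) \<le> K * exp (d * (2 * pi * \<bar>y\<bar>)) * exp (- pi / 2 * \<bar>y\<bar>)" .
    have "Complex 1 y \<notin> \<int>\<^sub>\<le>\<^sub>0" by (auto elim!: nonpos_Ints_cases simp: complex_eq_iff)
    hence "Gamma (Complex 2 y) = Complex 1 y * Gamma (Complex 1 y)"
      using Gamma_plus1[of "Complex 1 y"] by (simp add: Complex_eq add_ac)
    hence "norm (Gamma (Complex 2 y)) = norm (Complex 1 y) * norm (Gamma (Complex 1 y))"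
      by (simp add: norm_mult)
    also have "\<dots> \<le> (1 + \<bar>y\<bar>) * (K * exp (d * (2 * pi * \<bar>y\<bar>)) * exp (- pi / 2 * \<bar>y\<bar>))"
      using cmod_le[of "Complex 1 y"] by (intro mult_mono 1) auto
    also have "\<dots> \<le> (K * exp (d * (2 * \<bar>y\<bar>))) * (K * exp (d * (2 * pi * \<bar>y\<bar>)) * exp (- pi / 2 * \<bar>y\<bar>))"
    proof (rule mult_right_mono)
      have "1 + \<bar>y\<bar> \<le> 1 + 2 * \<bar>y\<bar>" by simp
      also have "\<dots> \<le> K * exp (d * (2 * \<bar>y\<bar>))"
        unfolding K_def using \<open>d > 0\<close> by (intro one_plus_le_exp) auto
      finally show "1 + \<bar>y\<bar> \<le> K * exp (d * (2 * \<bar>y\<bar>))" .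
    qed (use \<open>K > 0\<close> in auto)
    also have "\<dots> = K * K * exp (d * (2 * \<bar>y\<bar>) + d * (2 * pi * \<bar>y\<bar>) + (- pi / 2 * \<bar>y\<bar>))"
      by (simp only: exp_add mult_ac)
    also have "d * (2 * \<bar>y\<bar>) + d * (2 * pi * \<bar>y\<bar>) + (- pi / 2 * \<bar>y\<bar>) = d * (2 + 2 * pi) * \<bar>y\<bar> - pi / 2 * \<bar>y\<bar>"
      by (simp add: algebra_simps)
    also have "d * (2 + 2 * pi) = \<delta>"
      using pi_gt_zero by (simp add: d_def add_pos_pos less_imp_neq [symmetric])
    also have "\<delta> * \<bar>y\<bar> - pi / 2 * \<bar>y\<bar> = - (pi / 2 - \<delta>) * \<bar>y\<bar>"
      by (simp add: algebra_simps)
    finally have 2: "norm (Gamma (Complex 2 y)) \<le> K * K * exp (- (pi / 2 - \<delta>) * \<bar>y\<bar>)" .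
    have "Gamma (2::real) = 1" using Gamma_fact[of 1, where 'a = real] by simp
    hence "norm (Gamma s) \<le> Gamma (Re s) * norm (Gamma (Complex 2 y))"
      using norm_Gamma_div_Gamma_Re_mono[of s 2] s by (simp add: y_def)
    also have "\<dots> \<le> G * (K * K * exp (- (pi / 2 - \<delta>) * \<bar>y\<bar>))"
      using s \<open>G > 0\<close> by (intro mult_mono G 2) auto
    finally show "norm (Gamma s) \<le> G * K * K * exp (- (pi / 2 - \<delta>) * \<bar>Im s\<bar>)"
      by (simp add: y_def mult_ac)
  qed
qed

text \<open>The modulus of \<open>t powr (- s)\<close> is
  \<open>norm t powr (- Re s) * exp (Im s * Arg t)\<close>. Its growth rate is at most
  \<open>pi/2 - 2 * \<delta>\<close> and Gamma decays at rate \<open>pi/2 - \<delta>\<close>, so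
  rate \<open>\<delta>\<close> survives. The constant does not depend on \<open>t\<close>.\<close>

lemma norm_Gamma_kernel_bound:
  assumes "\<delta> > 0"
  shows "\<exists>C>0. \<forall>s t. 1/2 \<le> Re s \<longrightarrow> Re s \<le> 2 \<longrightarrow> \<bar>Arg t\<bar> \<le> pi / 2 - 2 * \<delta> \<longrightarrow>
           norm (Gamma s * t powr (- s)) \<le> C * norm t powr (- Re s) * exp (- \<delta> * \<bar>Im s\<bar>)"
proof -
  obtain C where C: "C > 0" "\<And>s. 1/2 \<le> Re s \<Longrightarrow> Re s \<le> 2 \<Longrightarrow> norm (Gamma s) \<le> C * exp (- (pi / 2 - \<delta>) * \<bar>Im s\<bar>)"
    using norm_Gamma_strip_bound[OF assms] by blast
  show ?thesis
  proof (intro exI[of _ C] conjI allI impI \<open>C > 0\<close>)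
    fix s t :: complex assume st: "1/2 \<le> Re s" "Re s \<le> 2" "\<bar>Arg t\<bar> \<le> pi / 2 - 2 * \<delta>"
    have "Im s * Arg t \<le> \<bar>Im s\<bar> * \<bar>Arg t\<bar>" by (metis abs_ge_self abs_mult)
    also have "\<dots> \<le> \<bar>Im s\<bar> * (pi / 2 - 2 * \<delta>)" using st by (intro mult_left_mono) auto
    finally have "exp (Im s * Arg t) \<le> exp (\<bar>Im s\<bar> * (pi / 2 - 2 * \<delta>))" by simp
    hence "norm (t powr (- s)) \<le> norm t powr (- Re s) * exp (\<bar>Im s\<bar> * (pi / 2 - 2 * \<delta>))"
      by (simp add: norm_powr_complex mult_left_mono)
    hence "norm (Gamma s * t powr (- s)) \<le> (C * exp (- (pi / 2 - \<delta>) * \<bar>Im s\<bar>)) *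
             (norm t powr (- Re s) * exp (\<bar>Im s\<bar> * (pi / 2 - 2 * \<delta>)))"
      unfolding norm_mult using C st by (intro mult_mono) auto
    also have "\<dots> = C * norm t powr (- Re s) * exp (- (pi / 2 - \<delta>) * \<bar>Im s\<bar> + \<bar>Im s\<bar> * (pi / 2 - 2 * \<delta>))"
      by (simp only: exp_add mult_ac)
    also have "- (pi / 2 - \<delta>) * \<bar>Im s\<bar> + \<bar>Im s\<bar> * (pi / 2 - 2 * \<delta>) = - \<delta> * \<bar>Im s\<bar>"
      by (simp add: algebra_simps)
    finally show "norm (Gamma s * t powr (- s)) \<le> C * norm t powr (- Re s) * exp (- \<delta> * \<bar>Im s\<bar>)" .
  qed
qed

section \<open>Integrals over vertical segments\<close>

text \<open>The two horizontal sides of the rectangle account for the whole difference. The contour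
  integral is kept as a term so that the lemma serves both where residues occur and where Cauchy's
  theorem makes it vanish.\<close>

lemma norm_vertical_integral_shift_le:
  fixes f :: "complex \<Rightarrow> complex"
  assumes "a < c" "T > 0" "B \<ge> 0"
    and cont: "continuous_on (cbox (Complex a (-T)) (Complex c T) - box (Complex a (-T)) (Complex c T)) f"
    and bound: "\<And>s. a \<le> Re s \<Longrightarrow> Re s \<le> c \<Longrightarrow> \<bar>Im s\<bar> = T \<Longrightarrow> norm (f s) \<le> B"
  shows "norm (\<i> * (integral {-T..T} (\<lambda>y. f (Complex c y)) - integral {-T..T} (\<lambda>y. f (Complex a y)))
               - contour_integral (rectpath (Complex a (-T)) (Complex c T)) f) \<le> 2 * B * (c - a)"
proof -
  define p1 p2 p3 p4 where "p1 = Complex a (-T)" and "p2 = Complex c (-T)"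
    and "p3 = Complex c T" and "p4 = Complex a T"
  note p_defs = p1_def p2_def p3_def p4_def
  have p1p3: "Re p1 \<le> Re p3" "Im p1 \<le> Im p3" using assms by (auto simp: p_defs)
  have "path_image (rectpath p1 p3) = closed_segment p1 p2 \<union> closed_segment p2 p3
          \<union> closed_segment p3 p4 \<union> closed_segment p4 p1"
    by (auto simp: rectpath_def Let_def path_image_join p_defs)
  moreover have "continuous_on (path_image (rectpath p1 p3)) f"
    using cont by (subst path_image_rectpath_cbox_minus_box[OF p1p3]) (simp add: p_defs)
  ultimately have cont': "continuous_on (closed_segment p1 p2) f" "continuous_on (closed_segment p2 p3) f"
    "continuous_on (closed_segment p3 p4) f" "continuous_on (closed_segment p4 p1) f"
    by (metis (no_types, lifting) continuous_on_subset le_sup_iff order_refl)+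
  note int = cont'[THEN contour_integrable_continuous_linepath]
  have "contour_integral (rectpath p1 p3) f = contour_integral (linepath p1 p2) f
    + contour_integral (linepath p2 p3) f + contour_integral (linepath p3 p4) f + contour_integral (linepath p4 p1) f"
    using int by (simp add: rectpath_def Let_def p_defs)
  moreover have "contour_integral (linepath p2 p3) f = \<i> * integral {-T..T} (\<lambda>y. f (Complex c y))"
    by (rule contour_integral_linepath_same_Re) (use assms in \<open>auto simp: p_defs\<close>)
  moreover have "contour_integral (linepath p4 p1) f = - (\<i> * integral {-T..T} (\<lambda>y. f (Complex a y)))"
    by (subst contour_integral_reverse_linepath[OF cont'(4)], subst contour_integral_linepath_same_Re)
       (use assms in \<open>auto simp: p_defs\<close>)
  moreover have "norm (contour_integral (linepath p1 p2) f) \<le> B * norm (p2 - p1)"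
    by (rule contour_integral_bound_linepath[OF int(1)])
       (use assms in \<open>auto simp: p_defs closed_segment_same_Im closed_segment_eq_real_ivl intro!: bound\<close>)
  moreover have "norm (contour_integral (linepath p3 p4) f) \<le> B * norm (p4 - p3)"
    by (rule contour_integral_bound_linepath[OF int(3)])
       (use assms in \<open>auto simp: p_defs closed_segment_same_Im closed_segment_eq_real_ivl intro!: bound\<close>)
  moreover have "norm (p2 - p1) = c - a" "norm (p4 - p3) = c - a"
    using assms by (auto simp: p_defs cmod_def)
  ultimately have "norm (- (contour_integral (linepath p1 p2) f + contour_integral (linepath p3 p4) f)) \<le> 2 * B * (c - a)"
    unfolding norm_minus_cancel by (intro norm_triangle_le) auto
  also have "- (contour_integral (linepath p1 p2) f + contour_integral (linepath p3 p4) f) =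
      \<i> * (integral {-T..T} (\<lambda>y. f (Complex c y)) - integral {-T..T} (\<lambda>y. f (Complex a y)))
               - contour_integral (rectpath p1 p3) f"
    using \<open>contour_integral (rectpath p1 p3) f = _\<close> \<open>contour_integral (linepath p2 p3) f = _\<close>
      \<open>contour_integral (linepath p4 p1) f = _\<close> by (simp add: algebra_simps)
  finally show ?thesis by (simp add: p_defs)
qed

lemma norm_integral_exp_decay_le:
  fixes f :: "real \<Rightarrow> complex"
  assumes "\<delta> > 0" "B \<ge> 0" "a \<le> b"
    and cont: "continuous_on {a..b} f"
    and bound: "\<And>y. y \<in> {a..b} \<Longrightarrow> norm (f y) \<le> B * exp (- \<delta> * y)"
  shows "norm (integral {a..b} f) \<le> B / \<delta> * exp (- \<delta> * a)"
proof -
  have "((\<lambda>y. B * exp (- \<delta> * y)) has_integral (- (B / \<delta>) * exp (- \<delta> * b) - (- (B / \<delta>) * exp (- \<delta> * a)))) {a..b}"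
    using assms by (intro fundamental_theorem_of_calculus)
      (auto intro!: derivative_eq_intros simp flip: has_real_derivative_iff_has_vector_derivative)
  hence "norm (integral {a..b} f) \<le> - (B / \<delta>) * exp (- \<delta> * b) - (- (B / \<delta>) * exp (- \<delta> * a))"
    using integral_norm_bound_integral[of f "{a..b}" "\<lambda>y. B * exp (- \<delta> * y)"] bound
      integrable_continuous_interval[OF cont] by (auto simp: has_integral_iff)
  also have "\<dots> \<le> B / \<delta> * exp (- \<delta> * a)" using assms by simp
  finally show ?thesis .
qed

text \<open>Besides truncation, the case \<open>L = 0\<close> bounds the whole integral over
  \<open>{-T..T}\<close>.\<close>

lemma norm_integral_tails_le:
  fixes f :: "real \<Rightarrow> complex"
  assumes "\<delta> > 0" "B \<ge> 0" "0 \<le> L" "L \<le> T"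
    and cont: "continuous_on {-T..T} f"
    and bound: "\<And>y. \<bar>y\<bar> \<le> T \<Longrightarrow> norm (f y) \<le> B * exp (- \<delta> * \<bar>y\<bar>)"
  shows "norm (integral {-T..T} f - integral {-L..L} f) \<le> 2 * B / \<delta> * exp (- \<delta> * L)"
proof -
  have int: "f integrable_on {a..b}" if "-T \<le> a" "b \<le> T" for a b
    by (rule integrable_continuous_interval, rule continuous_on_subset[OF cont]) (use that in auto)
  have "integral {-T..T} f = integral {-T..-L} f + integral {-L..T} f"
    using assms by (intro Henstock_Kurzweil_Integration.integral_combine [symmetric] int) auto
  also have "integral {-L..T} f = integral {-L..L} f + integral {L..T} f"
    using assms by (intro Henstock_Kurzweil_Integration.integral_combine [symmetric] int) auto
  finally have "integral {-T..T} f - integral {-L..L} f = integral {-T..-L} f + integral {L..T} f"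
    by simp
  moreover have "norm (integral {L..T} f) \<le> B / \<delta> * exp (- \<delta> * L)"
  proof (rule norm_integral_exp_decay_le)
    show "continuous_on {L..T} f" by (rule continuous_on_subset[OF cont]) (use assms in auto)
    show "norm (f y) \<le> B * exp (- \<delta> * y)" if "y \<in> {L..T}" for y
      using bound[of y] that assms by simp
  qed (use assms in auto)
  moreover have "norm (integral {L..T} (\<lambda>y. f (- y))) \<le> B / \<delta> * exp (- \<delta> * L)"
  proof (rule norm_integral_exp_decay_le)
    show "continuous_on {L..T} (\<lambda>y. f (- y))"
      by (rule continuous_on_compose2[OF cont]) (use assms in \<open>auto intro!: continuous_intros\<close>)
    show "norm (f (- y)) \<le> B * exp (- \<delta> * y)" if "y \<in> {L..T}" for y
      using bound[of "- y"] that assms by simp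
  qed (use assms in auto)
  moreover have "integral {-T..-L} f = integral {L..T} (\<lambda>y. f (- y))"
    using Henstock_Kurzweil_Integration.integral_reflect_real[of T L "\<lambda>y. f (- y)"] by simp
  ultimately show ?thesis
    using norm_triangle_ineq[of "integral {-T..-L} f" "integral {L..T} f"] by simp
qed

section \<open>A truncated Cahen--Mellin formula\<close>

text \<open>The functional equation of Gamma: moving one unit to the left costs the factor
  \<open>t / s\<close>. This carries the strip bound to all the left half-plane by
  induction.\<close>

lemma Gamma_kernel_shift:
  fixes s t :: complex
  assumes "s \<notin> \<int>\<^sub>\<le>\<^sub>0" "t \<noteq> 0"
  shows "Gamma s * t powr (- s) = Gamma (s + 1) * t powr (- (s + 1)) * (t / s)"
proof -
  have "s \<noteq> 0" using assms by auto
  thus ?thesis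
    using assms Gamma_plus1[of s] by (simp add: powr_diff field_simps powr_add powr_minus)
qed

lemma contour_integral_Gamma_kernel:
  fixes t :: complex
  assumes "t \<noteq> 0" "T > 0"
  shows "contour_integral (rectpath (Complex (1/2 - real N) (-T)) (Complex 2 T)) (\<lambda>s. Gamma s * t powr (- s))
         = 2 * pi * \<i> * (\<Sum>k<N. (- t) ^ k /\<^sub>R fact k)"
proof -
  let ?f = "\<lambda>s. Gamma s * t powr (- s)" and ?g = "rectpath (Complex (1/2 - real N) (-T)) (Complex 2 T)"
  \<comment> \<open>The rectangle has left edge \<open>1/2 - N\<close>, midway between poles, so it
    encloses exactly \<open>0, -1, ..., -(N - 1)\<close>. The half-plane \<open>S\<close> contains
    the rectangle and omits the next pole \<open>- N\<close>.\<close>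
  define S where "S = {s. Re s > - real N}"
  define pts where "pts = (\<lambda>k. - of_nat k :: complex) ` {..<N}"
  have box: "p \<in> box (Complex (1/2 - real N) (-T)) (Complex 2 T)" if "p \<in> pts" for p
    using that assms by (auto simp: pts_def in_box_complex_iff)
  have path: "path_image ?g = cbox (Complex (1/2 - real N) (-T)) (Complex 2 T) - box (Complex (1/2 - real N) (-T)) (Complex 2 T)"
    using assms by (intro path_image_rectpath_cbox_minus_box) auto
  have sub: "path_image ?g \<subseteq> S"
    by (auto simp: path S_def in_cbox_complex_iff)
  have holo: "?f holomorphic_on A" if "A \<inter> \<int>\<^sub>\<le>\<^sub>0 = {}" for A
    using that assms by (intro holomorphic_intros) auto
  have "contour_integral ?g ?f = 2 * pi * \<i> * (\<Sum>p\<in>pts. winding_number ?g p * residue ?f p)"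
  proof (rule Residue_theorem)
    show "open S" unfolding S_def by (rule open_halfspace_Re_gt)
    show "connected S" unfolding S_def by (intro convex_connected convex_halfspace_Re_gt)
    show "?f holomorphic_on S - pts"
      by (rule holo) (auto simp: S_def pts_def elim!: nonpos_Ints_cases')
    show "path_image ?g \<subseteq> S - pts" using sub box path by blast
    show "\<forall>z. z \<notin> S \<longrightarrow> winding_number ?g z = 0"
      using sub by (auto intro!: winding_number_zero_outside[of _ S] simp: S_def convex_halfspace_Re_gt)
  qed (auto simp: pts_def)
  also have "(\<Sum>p\<in>pts. winding_number ?g p * residue ?f p) = (\<Sum>p\<in>pts. residue ?f p)"
    using box by (intro sum.cong refl) (simp add: winding_number_rectpath)
  also have "\<dots> = (\<Sum>k<N. residue ?f (- of_nat k))"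
    unfolding pts_def by (subst sum.reindex) (auto simp: inj_on_def)
  also have "\<dots> = (\<Sum>k<N. (- t) ^ k /\<^sub>R fact k)"
  \<comment> \<open>Each pole is simple: on the open set that omits all the other poles, the residue
    is the limit of the kernel times \<open>s + k\<close>, which is
    \<open>(-1) ^ k / fact k * t ^ k\<close>.\<close>
  proof (intro sum.cong refl residue_simple')
    fix k
    show "open (- (\<int>\<^sub>\<le>\<^sub>0 - {-of_nat k}) :: complex set)"
      by (intro open_Compl closed_subset_Ints) auto
    show "?f holomorphic_on (- (\<int>\<^sub>\<le>\<^sub>0 - {-of_nat k}) - {- of_nat k})"
      by (rule holo) auto
    have "(\<lambda>s. (Gamma s * (s + of_nat k)) * t powr (- s)) \<midarrow>(- of_nat k)\<rightarrow> (-1) ^ k / fact k * t powr (- (- of_nat k))"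
      unfolding powr_def using assms by (simp only: if_False) (intro tendsto_intros Gamma_residues)
    moreover have "(-1) ^ k / fact k * t powr (- (- of_nat k)) = (- t) ^ k /\<^sub>R fact k"
      using assms by (simp add: power_minus[of t] scaleR_conv_of_real field_simps)
    ultimately show "(\<lambda>s. ?f s * (s - - of_nat k)) \<midarrow>(- of_nat k)\<rightarrow> (- t) ^ k /\<^sub>R fact k"
      by (simp add: mult_ac)
  qed auto
  finally show ?thesis .
qed

text \<open>Isolates what the Mellin argument needs of \<open>t\<close>. It is instantiated both
  with \<open>t\<close> and with its multiples \<open>n * t\<close>, with the same \<open>C\<close>
  and \<open>\<delta>\<close>, because positive multiples have the same argument.\<close>

locale Gamma_kernel =
  fixes t :: complex and C \<delta> :: real
  assumes t_nz: "t \<noteq> 0" and C_pos: "C > 0" and \<delta>_pos: "\<delta> > 0"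
    and strip_bound: "\<And>s. 1/2 \<le> Re s \<Longrightarrow> Re s \<le> 2 \<Longrightarrow>
          norm (Gamma s * t powr (- s)) \<le> C * norm t powr (- Re s) * exp (- \<delta> * \<bar>Im s\<bar>)"
begin

text \<open>Controls the horizontal sides. Away from the real axis \<open>norm s \<ge> 1\<close>, so
  each unit step to the left costs at most \<open>norm t\<close>, which is exactly the change in
  \<open>norm t powr (- Re s)\<close>.\<close>

lemma norm_kernel_le_of_Im_ge_1:
  "1/2 - real N \<le> Re s \<Longrightarrow> Re s \<le> 2 \<Longrightarrow> \<bar>Im s\<bar> \<ge> 1 \<Longrightarrow>
     norm (Gamma s * t powr (- s)) \<le> C * norm t powr (- Re s) * exp (- \<delta> * \<bar>Im s\<bar>)"
proof (induction N arbitrary: s)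
  case 0
  thus ?case using strip_bound by simp
next
  case (Suc N)
  show ?case
  proof (cases "Re s \<ge> 1/2")
    case True
    thus ?thesis using strip_bound Suc.prems by simp
  next
    case False
    have "norm s \<ge> 1" using Suc.prems abs_Im_le_cmod[of s] by linarith
    hence "norm t / norm s \<le> norm t"
      using divide_left_mono[of 1 "norm s" "norm t"] by (cases "s = 0") auto
    have "s \<notin> \<int>\<^sub>\<le>\<^sub>0" using Suc.prems by (auto elim!: nonpos_Ints_cases)
    hence "norm (Gamma s * t powr (- s)) = norm (Gamma (s + 1) * t powr (- (s + 1))) * (norm t / norm s)"
      by (subst Gamma_kernel_shift) (use t_nz in \<open>auto simp: norm_mult norm_divide\<close>)
    also have "\<dots> \<le> (C * norm t powr (- Re (s + 1)) * exp (- \<delta> * \<bar>Im (s + 1)\<bar>)) * norm t"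
      using Suc.prems False C_pos \<open>norm t / norm s \<le> norm t\<close>
      by (intro mult_mono Suc.IH) auto
    also have "\<dots> = C * (norm t powr (- Re s - 1) * norm t powr 1) * exp (- \<delta> * \<bar>Im s\<bar>)"
      using t_nz by (simp add: mult_ac)
    also have "norm t powr (- Re s - 1) * norm t powr 1 = norm t powr (- Re s)"
      unfolding powr_add [symmetric] by simp
    finally show ?thesis .
  qed
qed

text \<open>Controls the left vertical side. Here the divisions by \<open>s\<close> are retained,
  and they accumulate to the factor \<open>2 ^ N / fact N\<close> that makes this side vanish as
  \<open>N\<close> grows.\<close>

lemma norm_kernel_le_of_Re_eq:
  "Re s = 1/2 - real N \<Longrightarrow>
     norm (Gamma s * t powr (- s)) \<le> C * (2 ^ N / fact N) * norm t powr (real N - 1/2) * exp (- \<delta> * \<bar>Im s\<bar>)"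
proof (induction N arbitrary: s)
  case 0
  hence "Re s = 1/2" by simp
  thus ?case using strip_bound[of s] by (simp add: \<open>Re s = 1/2\<close>)
next
  case (Suc N)
  \<comment> \<open>The real part has modulus \<open>N + 1/2\<close>, which is at least
    \<open>(N + 1) / 2\<close>.\<close>
  have "real (Suc N) / 2 \<le> norm s" using Suc.prems abs_Re_le_cmod[of s] by simp
  moreover from this have "norm s > 0" by (rule less_le_trans[rotated]) simp
  ultimately have "norm t / norm s \<le> norm t / (real (Suc N) / 2)"
    by (intro divide_left_mono mult_pos_pos) auto
  \<comment> \<open>By parity, a half-integer is never a pole.\<close>
  have "Re s + real n \<noteq> 0" for n
  proof
    assume "Re s + real n = 0"
    hence "real (2 * n + 1) = real (2 * Suc N)" using Suc.prems by simp
    hence "2 * n + 1 = 2 * Suc N" by (simp only: of_nat_eq_iff)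
    thus False by presburger
  qed
  hence "s \<notin> \<int>\<^sub>\<le>\<^sub>0" by (force elim!: nonpos_Ints_cases')
  hence "norm (Gamma s * t powr (- s)) = norm (Gamma (s + 1) * t powr (- (s + 1))) * (norm t / norm s)"
    by (subst Gamma_kernel_shift) (use t_nz in \<open>auto simp: norm_mult norm_divide\<close>)
  also have "\<dots> \<le> (C * (2 ^ N / fact N) * norm t powr (real N - 1/2) * exp (- \<delta> * \<bar>Im (s + 1)\<bar>)) * (norm t / (real (Suc N) / 2))"
    using Suc.prems C_pos \<open>norm t / norm s \<le> norm t / (real (Suc N) / 2)\<close>
    by (intro mult_mono Suc.IH) auto
  also have "\<dots> = C * (2 ^ Suc N / fact (Suc N)) * (norm t powr (real N - 1/2) * norm t powr 1) * exp (- \<delta> * \<bar>Im s\<bar>)"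
    using t_nz by (simp add: mult_ac)
  also have "norm t powr (real N - 1/2) * norm t powr 1 = norm t powr (real (Suc N) - 1/2)"
    unfolding powr_add [symmetric] by (simp add: add_ac)
  finally show ?case .
qed

lemma continuous_on_kernel:
  "A \<inter> \<int>\<^sub>\<le>\<^sub>0 = {} \<Longrightarrow> continuous_on A (\<lambda>s. Gamma s * t powr (- s))"
  unfolding powr_def using t_nz by (simp only: if_False) (intro continuous_intros; blast)

lemma continuous_on_kernel_vertical:
  assumes "a \<notin> \<int>\<^sub>\<le>\<^sub>0"
  shows "continuous_on A (\<lambda>y. Gamma (Complex a y) * t powr (- Complex a y))"
proof (rule continuous_on_compose2[OF continuous_on_kernel[of "{s. Re s = a}"]])
  show "{s. Re s = a} \<inter> \<int>\<^sub>\<le>\<^sub>0 = {}"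
    using assms by (auto elim!: nonpos_Ints_cases intro: nonpos_Ints_of_int)
  show "continuous_on A (Complex a)"
    unfolding Complex_eq by (intro continuous_intros)
qed auto

text \<open>The residues of the kernel at \<open>0, -1, -2, \<dots>\<close> are the terms of the exponential series of \<open>- t\<close>; the
  lines \<open>Re s = 1/2 - N\<close> contribute \<open>O((2\<bar>t\<bar>)\<^sup>N / N!)\<close>.\<close>

lemma Cahen_Mellin_truncated:
  assumes "L \<ge> 0"
  shows "norm (integral {-L..L} (\<lambda>y. Gamma (Complex 2 y) * t powr (- Complex 2 y)) - 2 * pi * exp (- t))
           \<le> 2 * C / \<delta> * norm t powr (-2) * exp (- \<delta> * L)"
proof -
  define k where "k = (\<lambda>s. Gamma s * t powr (- s))"
  define I where "I = (\<lambda>T. integral {-T..T} (\<lambda>y. k (Complex 2 y)))"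
  define S where "S = (\<lambda>N. \<Sum>j<N. (- t) ^ j /\<^sub>R fact j)"
  define E where "E = 2 * C / \<delta> * norm t powr (-2) * exp (- \<delta> * L)"
  define R where "R = (\<lambda>N. 2 * C / \<delta> * (2 ^ N / fact N * norm t powr (real N - 1/2)))"
  have bound: "norm (I L - 2 * pi * S N) \<le> E + R N" for N
  \<comment> \<open>Fixed \<open>N\<close>, with \<open>T\<close> tending to infinity:
    \<open>E\<close> pays for cutting the line \<open>Re s = 2\<close> at \<open>L\<close>,
    \<open>R N\<close> for the left side, and \<open>?h T\<close> for the horizontal sides, which
    disappears in the limit. The constant \<open>M\<close> bounds
    \<open>norm t powr (- Re s)\<close> across the rectangle whether \<open>norm t\<close> is below
    or above 1.\<close>
  proof (rule tendsto_lowerbound)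
    define M where "M = exp ((real N + 2) * \<bar>ln (norm t)\<bar>)"
    let ?h = "\<lambda>T. 2 * (C * M * exp (- \<delta> * T)) * (2 - (1/2 - real N))"
    have "((\<lambda>T. E + (R N + ?h T)) \<longlongrightarrow> E + (R N + 2 * (C * M * 0) * (2 - (1/2 - real N)))) at_top"
    proof (intro tendsto_intros)
      show "((\<lambda>T. exp (- \<delta> * T)) \<longlongrightarrow> 0) at_top" using \<delta>_pos by real_asymp
    qed
    thus "((\<lambda>T. E + (R N + ?h T)) \<longlongrightarrow> E + R N) at_top" by simp
    show "eventually (\<lambda>T. norm (I L - 2 * pi * S N) \<le> E + (R N + ?h T)) at_top"
      using eventually_ge_at_top[of "max 1 L"]
    proof eventually_elim
      case (elim T)
      hence T: "T \<ge> 1" "T \<ge> L" by auto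
      let ?J = "integral {-T..T} (\<lambda>y. k (Complex (1/2 - real N) y))"
      have half: "1/2 - real N \<notin> \<int>"
      proof
        assume "1/2 - real N \<in> \<int>"
        then obtain m where "1/2 - real N = of_int m" by (auto elim: Ints_cases)
        hence "of_int 1 = (of_int (2 * (m + int N)) :: real)" by simp
        hence "1 = 2 * (m + int N)" by (simp only: of_int_eq_iff)
        thus False by presburger
      qed
      hence half': "1/2 - real N \<notin> \<int>\<^sub>\<le>\<^sub>0" using nonpos_Ints_Int by blast
      have 1: "norm (I T - I L) \<le> E"
        unfolding I_def
      proof (rule norm_integral_tails_le[THEN order_trans])
        show "norm (k (Complex 2 y)) \<le> C * norm t powr (-2) * exp (- \<delta> * \<bar>y\<bar>)" for y
          using strip_bound[of "Complex 2 y"] by (simp add: k_def)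
      qed (use T assms C_pos \<delta>_pos continuous_on_kernel_vertical[of 2] in \<open>auto simp: E_def k_def\<close>)
      have 2: "norm ?J \<le> R N"
      proof -
        have "norm (?J - integral {-0..0} (\<lambda>y. k (Complex (1/2 - real N) y)))
                \<le> 2 * (C * (2 ^ N / fact N) * norm t powr (real N - 1/2)) / \<delta> * exp (- \<delta> * 0)"
        proof (rule norm_integral_tails_le)
          show "norm (k (Complex (1/2 - real N) y)) \<le>
              C * (2 ^ N / fact N) * norm t powr (real N - 1/2) * exp (- \<delta> * \<bar>y\<bar>)" for y
            using norm_kernel_le_of_Re_eq[of "Complex (1/2 - real N) y" N] by (simp add: k_def)
        qed (use T C_pos \<delta>_pos continuous_on_kernel_vertical[OF half']
               in \<open>auto simp: k_def\<close>)
        thus ?thesis by (simp add: R_def mult_ac)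
      qed
      have "norm (\<i> * (I T - ?J) - contour_integral (rectpath (Complex (1/2 - real N) (-T)) (Complex 2 T)) k)
              \<le> ?h T"
        unfolding I_def
      proof (rule norm_vertical_integral_shift_le)
        show "norm (k s) \<le> C * M * exp (- \<delta> * T)"
          if s: "1/2 - real N \<le> Re s" "Re s \<le> 2" "\<bar>Im s\<bar> = T" for s
        proof -
          have "norm t powr (- Re s) = exp (- Re s * ln (norm t))"
            using t_nz by (simp add: powr_def)
          also have "- Re s * ln (norm t) \<le> \<bar>Re s\<bar> * \<bar>ln (norm t)\<bar>"
            by (metis abs_ge_self abs_minus_cancel abs_mult)
          also have "\<bar>Re s\<bar> * \<bar>ln (norm t)\<bar> \<le> (real N + 2) * \<bar>ln (norm t)\<bar>"
            using s by (intro mult_right_mono) auto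
          finally have "norm t powr (- Re s) \<le> M" by (simp add: M_def)
          hence "C * norm t powr (- Re s) * exp (- \<delta> * \<bar>Im s\<bar>) \<le> C * M * exp (- \<delta> * T)"
            using C_pos s by (intro mult_mono) (auto simp: M_def)
          thus ?thesis
            using norm_kernel_le_of_Im_ge_1[of N s] s T by (simp add: k_def)
        qed
        have "s \<notin> \<int>\<^sub>\<le>\<^sub>0" if s: "s \<in> cbox (Complex (1/2 - real N) (-T)) (Complex 2 T) -
                 box (Complex (1/2 - real N) (-T)) (Complex 2 T)" for s
        proof
          assume "s \<in> \<int>\<^sub>\<le>\<^sub>0"
          then obtain n where n: "s = - of_nat n" by (elim nonpos_Ints_cases')
          have "1/2 - real N \<noteq> - real n" using half by (metis Ints_minus Ints_of_nat)
          thus False using s T n by (auto simp: in_cbox_complex_iff in_box_complex_iff)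
        qed
        thus "continuous_on (cbox (Complex (1/2 - real N) (-T)) (Complex 2 T) -
                 box (Complex (1/2 - real N) (-T)) (Complex 2 T)) k"
          unfolding k_def by (intro continuous_on_kernel) auto
      qed (use T C_pos in \<open>auto simp: M_def\<close>)
      also have "contour_integral (rectpath (Complex (1/2 - real N) (-T)) (Complex 2 T)) k = \<i> * (2 * pi * S N)"
        using contour_integral_Gamma_kernel[OF t_nz, of T N] T by (simp add: k_def S_def mult_ac)
      also have "\<i> * (I T - ?J) - \<i> * (2 * pi * S N) = \<i> * (I T - ?J - 2 * pi * S N)"
        by (simp add: algebra_simps)
      also have "norm \<dots> = norm (I T - ?J - 2 * pi * S N)"
        by (simp add: norm_mult)
      finally have 3: "norm (I T - ?J - 2 * pi * S N) \<le> ?h T" .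
      have "I L - 2 * pi * S N = - (I T - I L) + (?J + (I T - ?J - 2 * pi * S N))" by simp
      also have "norm \<dots> \<le> E + (R N + ?h T)"
        using 1 2 3 by (intro norm_triangle_mono) (simp_all only: norm_minus_cancel)
      finally show ?case .
    qed
  qed auto
  have "norm (I L - 2 * pi * exp (- t)) \<le> E"
  \<comment> \<open>Now \<open>N\<close> tends to infinity: the residue sums converge to
    \<open>exp (- t)\<close>, and \<open>R N\<close> is a multiple of a term of the exponential
    series of \<open>2 * norm t\<close>.\<close>
  proof (rule tendsto_le[OF sequentially_bot])
    have "S \<longlonglongrightarrow> exp (- t)"
      unfolding S_def exp_def using summable_LIMSEQ[OF summable_exp_generic[of "- t"]] by simp
    thus "(\<lambda>N. norm (I L - 2 * pi * S N)) \<longlonglongrightarrow> norm (I L - 2 * pi * exp (- t))"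
      by (intro tendsto_intros)
    have R: "R N = 2 * C / \<delta> * norm t powr (-1/2) * (inverse (fact N) * (2 * norm t) ^ N)" for N
    proof -
      have pow: "norm t powr (real N - 1/2) = norm t ^ N * norm t powr (-1/2)"
        using powr_add[of "norm t" "real N" "-1/2"] t_nz by (simp add: powr_realpow)
      show ?thesis unfolding R_def pow power_mult_distrib by (simp add: field_simps)
    qed
    have "(\<lambda>N. inverse (fact N) * (2 * norm t) ^ N) \<longlonglongrightarrow> 0"
      using summable_LIMSEQ_zero[OF summable_exp[of "2 * norm t"]] .
    hence "R \<longlonglongrightarrow> 2 * C / \<delta> * norm t powr (-1/2) * 0"
      unfolding R by (intro tendsto_intros)
    thus "(\<lambda>N. E + R N) \<longlonglongrightarrow> E"
      using tendsto_add[OF tendsto_const[of E], of R 0] by simp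
  qed (use bound in auto)
  thus ?thesis by (simp add: I_def k_def E_def)
qed

end

section \<open>The boundary function and the sector\<close>

text \<open>The condition \<open>w > exp 1\<close> makes \<open>ln u\<close> and
  \<open>ln (ln u)\<close> positive for \<open>u \<ge> w\<close>, so both negative powers decrease.
  Monotonicity is what puts a full rectangle with left edge \<open>g(L)\<close> inside
  \<open>Omega\<close>.\<close>

lemma gfun_mono:
  assumes "\<alpha> > 0" "\<beta> > 0" "b > 0" "w > exp 1" "\<bar>x\<bar> \<le> \<bar>y\<bar>"
  shows "gfun \<alpha> \<beta> b w x \<le> gfun \<alpha> \<beta> b w y"
proof -
  define h where "h = (\<lambda>u. b * ln u powr (-\<alpha>) * ln (ln u) powr (-\<beta>))"
  have antimono: "h v \<le> h u" if "w \<le> u" "u \<le> v" for u v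
  proof -
    have "exp 1 < u" using that assms by simp
    hence "u > 0" using exp_gt_zero[of 1] by linarith
    have "ln u > 1" using \<open>exp 1 < u\<close> \<open>u > 0\<close> by (metis exp_less_cancel_iff exp_ln)
    moreover have "ln u \<le> ln v" using \<open>u > 0\<close> that by simp
    moreover have "ln (ln u) > 0" using \<open>ln u > 1\<close> by simp
    moreover have "ln (ln u) \<le> ln (ln v)" using \<open>ln u > 1\<close> \<open>ln u \<le> ln v\<close> by simp
    ultimately show ?thesis
      unfolding h_def using assms by (intro mult_mono powr_mono2') auto
  qed
  have gfun: "gfun \<alpha> \<beta> b w z = 1 - h (max w \<bar>z\<bar>)" for z
    by (simp add: gfun_def h_def max_def)
  have "h (max w \<bar>y\<bar>) \<le> h (max w \<bar>x\<bar>)"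
    by (rule antimono) (use assms in auto)
  thus ?thesis by (simp add: gfun)
qed

lemma gfun_tendsto_1:
  assumes "\<alpha> > 0" "\<beta> > 0"
  shows "(gfun \<alpha> \<beta> b w \<longlongrightarrow> 1) at_top"
proof -
  have "((\<lambda>u. 1 - b * ln u powr (-\<alpha>) * ln (ln u) powr (-\<beta>)) \<longlongrightarrow> 1) at_top"
    using assms by real_asymp
  moreover have "eventually (\<lambda>u. 1 - b * ln u powr (-\<alpha>) * ln (ln u) powr (-\<beta>) = gfun \<alpha> \<beta> b w u) at_top"
    using eventually_ge_at_top[of "max 0 w"] by eventually_elim (auto simp: gfun_def)
  ultimately show ?thesis by (rule Lim_transform_eventually)
qed

text \<open>With \<open>X = ln (1 / norm t)\<close> and \<open>L = K * X\<close>, the left side is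
  the exponent in \<open>norm t powr (- g(L))\<close>. Replacing \<open>ln (K * X)\<close> by
  \<open>ln X\<close> changes the saving by a ratio tending to 1, which \<open>\<epsilon>\<close>
  absorbs.\<close>

lemma eventually_gfun_scaled_le:
  fixes \<alpha> \<beta> b w K \<epsilon> :: real
  assumes "\<alpha> > 0" "\<beta> > 0" "b > 0" "K > 0" "\<epsilon> > 0"
  shows "eventually (\<lambda>X. X * gfun \<alpha> \<beta> b w (K * X) \<le>
           X - (b - \<epsilon>) * X / (ln X powr \<alpha> * ln (ln X) powr \<beta>)) at_top"
proof -
  have "((\<lambda>X. b * ln (K * X) powr (-\<alpha>) * ln (ln (K * X)) powr (-\<beta>) * (ln X powr \<alpha> * ln (ln X) powr \<beta>)) \<longlongrightarrow> b) at_top"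
    using assms by real_asymp
  hence "eventually (\<lambda>X. b * ln (K * X) powr (-\<alpha>) * ln (ln (K * X)) powr (-\<beta>) * (ln X powr \<alpha> * ln (ln X) powr \<beta>) > b - \<epsilon>) at_top"
    using assms by (intro order_tendstoD) auto
  moreover have "eventually (\<lambda>X. ln X powr \<alpha> * ln (ln X) powr \<beta> > 0) at_top"
    using assms by real_asymp
  moreover have "filterlim (\<lambda>X. K * X) at_top at_top"
    using assms by real_asymp
  hence "eventually (\<lambda>X. K * X \<ge> max w 1) at_top" unfolding filterlim_at_top by blast
  hence "eventually (\<lambda>X. K * X \<ge> w \<and> K * X > 0 \<and> X > 0) at_top"
    using eventually_gt_at_top[of 0] by eventually_elim (use assms in auto)
  ultimately show ?thesis
  proof eventually_elim
    case (elim X)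
    define D h where "D = ln X powr \<alpha> * ln (ln X) powr \<beta>" and "h = b * ln (K * X) powr (-\<alpha>) * ln (ln (K * X)) powr (-\<beta>)"
    have "(b - \<epsilon>) / D \<le> h" using elim by (simp add: D_def [symmetric] h_def [symmetric] divide_le_eq)
    hence "X * ((b - \<epsilon>) / D) \<le> X * h" using elim by (intro mult_left_mono) auto
    moreover have "gfun \<alpha> \<beta> b w (K * X) = 1 - h" using elim by (simp add: gfun_def h_def)
    ultimately show ?case by (simp add: D_def [symmetric] right_diff_distrib mult.commute)
  qed
qed

text \<open>Ensures that bounded error terms are dominated by the exponential of the target
  exponent.\<close>

lemma eventually_exponent_nonneg:
  fixes \<alpha> \<beta> c :: real
  assumes "\<alpha> > 0" "\<beta> > 0"
  shows "eventually (\<lambda>X. 0 \<le> X - c * X / (ln X powr \<alpha> * ln (ln X) powr \<beta>)) at_top"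
proof -
  have "((\<lambda>X. c / (ln X powr \<alpha> * ln (ln X) powr \<beta>)) \<longlongrightarrow> 0) at_top"
    using assms by real_asymp
  hence "eventually (\<lambda>X. c / (ln X powr \<alpha> * ln (ln X) powr \<beta>) < 1) at_top"
    by (rule order_tendstoD) simp
  thus ?thesis using eventually_gt_at_top[of 0]
  proof eventually_elim
    case (elim X)
    hence "X * (c / (ln X powr \<alpha> * ln (ln X) powr \<beta>)) \<le> X * 1" by (intro mult_left_mono) auto
    thus ?case by (simp add: mult.commute)
  qed
qed

text \<open>The derivative of \<open>Ln\<close> at 1 gives
  \<open>- Ln z / (1 - z) \<longrightarrow> 1\<close>, so the arguments of \<open>- Ln z\<close> and
  \<open>1 - z\<close> eventually differ by less than \<open>\<theta> / 2\<close>. They add without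
  wrap-around since the sum stays below \<open>pi / 2\<close> in modulus.\<close>

lemma eventually_Arg_uminus_Ln_sector:
  assumes "\<theta> > 0"
  shows "eventually (\<lambda>z. \<bar>Arg (- Ln z)\<bar> \<le> pi / 2 - \<theta> / 2) (at 1 within sector \<theta>)"
proof -
  have quot: "(Ln z - Ln 1) / (z - 1) = - Ln z / (1 - z)" for z :: complex
    using minus_divide_divide[of "Ln z" "z - 1"] by simp
  have "((\<lambda>z. (Ln z - Ln 1) / (z - 1)) \<longlongrightarrow> inverse 1) (at 1 within sector \<theta>)"
    using has_field_derivative_at_within[OF has_field_derivative_Ln[of 1]]
    unfolding has_field_derivative_iff by simp
  hence lim: "((\<lambda>z. - Ln z / (1 - z)) \<longlongrightarrow> 1) (at 1 within sector \<theta>)"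
    unfolding quot by simp
  have "isCont Arg 1" by (rule continuous_at_Arg) auto
  hence "((\<lambda>z. Arg (- Ln z / (1 - z))) \<longlongrightarrow> Arg 1) (at 1 within sector \<theta>)"
    by (rule isCont_tendsto_compose[OF _ lim])
  hence "eventually (\<lambda>z. \<bar>Arg (- Ln z / (1 - z))\<bar> < \<theta> / 2) (at 1 within sector \<theta>)"
    using assms by (auto dest!: tendstoD[where e = "\<theta>/2"] simp: dist_real_def)
  moreover have "eventually (\<lambda>z. - Ln z / (1 - z) \<noteq> 0) (at 1 within sector \<theta>)"
    by (rule tendsto_imp_eventually_ne[OF lim]) simp
  moreover have "eventually (\<lambda>z. z \<in> sector \<theta> \<and> z \<noteq> 1) (at 1 within sector \<theta>)"
    by (auto simp: eventually_at_filter)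
  ultimately show ?thesis
  proof eventually_elim
    case (elim z)
    have "Arg (- Ln z / (1 - z) * (1 - z)) = Arg (- Ln z / (1 - z)) + Arg (1 - z)"
      using elim assms by (intro Arg_times) (auto simp: sector_def abs_le_iff abs_less_iff)
    hence "Arg (- Ln z) = Arg (- Ln z / (1 - z)) + Arg (1 - z)" using elim by simp
    thus ?case using elim by (auto simp: sector_def)
  qed
qed

lemma filterlim_ln_inverse_norm_Ln:
  "filterlim (\<lambda>z. ln (1 / norm (- Ln z))) at_top (at 1 within A)"
proof -
  have "((\<lambda>z. norm (- Ln z)) \<longlongrightarrow> norm (- Ln 1)) (at 1 within A)"
    by (intro tendsto_intros) auto
  moreover have "eventually (\<lambda>z. z \<noteq> 1 \<and> z \<noteq> 0) (at 1 within A)"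
    using eventually_neq_at_within[of 0 "1::complex" A] eventually_neq_at_within[of 1 "1::complex" A] 
    by eventually_elim auto
  hence "eventually (\<lambda>z. norm (- Ln z) > 0) (at 1 within A)"
    by eventually_elim (metis exp_Ln exp_zero neg_equal_0_iff_equal zero_less_norm_iff)
  ultimately have "filterlim (\<lambda>z. norm (- Ln z)) (at_right 0) (at 1 within A)"
    by (auto intro!: tendsto_imp_filterlim_at_right)
  moreover have "filterlim (\<lambda>x::real. ln (1 / x)) at_top (at_right 0)" by real_asymp
  ultimately show ?thesis by (rule filterlim_compose[rotated])
qed

section \<open>Shifting the contour\<close>

text \<open>Termwise use of the truncated formula: \<open>n powr (- s) * t powr (- s)\<close> is
  \<open>(n * t) powr (- s)\<close>, so the \<open>n\<close>-th term is the kernel integral for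
  \<open>n * t\<close>. Its truncation error carries \<open>n powr (-2)\<close>, which is summable
  against \<open>a\<close> by absolute convergence at \<open>s = 2\<close>.\<close>

lemma norm_Dirichlet_vertical_integral_minus_exp_series_le:
  fixes a :: "nat \<Rightarrow> complex"
  assumes \<delta>: "\<delta> > 0" and C: "C > 0" and L: "L \<ge> 0" and t: "t \<noteq> 0" "\<bar>Arg t\<bar> \<le> pi / 2 - 2 * \<delta>"
    and kernel: "\<And>s t. 1/2 \<le> Re s \<Longrightarrow> Re s \<le> 2 \<Longrightarrow> \<bar>Arg t\<bar> \<le> pi / 2 - 2 * \<delta> \<Longrightarrow>
           norm (Gamma s * t powr (- s)) \<le> C * norm t powr (- Re s) * exp (- \<delta> * \<bar>Im s\<bar>)"
    and summable: "summable (\<lambda>n. norm (a (Suc n)) * real (Suc n) powr (-2))"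
  shows "norm (integral {-L..L} (\<lambda>y. dirichlet_series a (Complex 2 y) * (Gamma (Complex 2 y) * t powr (- Complex 2 y)))
               - 2 * pi * (\<Sum>n. a (Suc n) * exp (- (of_nat (Suc n) * t))))
         \<le> 2 * C / \<delta> * (\<Sum>n. norm (a (Suc n)) * real (Suc n) powr (-2)) * norm t powr (-2) * exp (- \<delta> * L)"
proof -
  define k where "k = (\<lambda>s. Gamma s * t powr (- s))"
  define d where "d = (\<lambda>n. norm (a (Suc n)) * real (Suc n) powr (-2))"
  define f where "f = (\<lambda>n y. a (Suc n) * of_nat (Suc n) powr (- Complex 2 y) * k (Complex 2 y))"
  define J where "J = integral {-L..L} (\<lambda>y. dirichlet_series a (Complex 2 y) * k (Complex 2 y))"
  define B where "B = 2 * C / \<delta> * norm t powr (-2) * exp (- \<delta> * L)"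
  have norm_term: "norm (a (Suc n) * of_nat (Suc n) powr (- Complex 2 y)) = d n" for n y
    by (simp add: d_def norm_mult norm_powr_real_powr del: of_nat_Suc)
  interpret k: Gamma_kernel t C \<delta>
    by unfold_locales (use t C \<delta> kernel in auto)

  have sums_D: "(\<lambda>n. f n y) sums (dirichlet_series a (Complex 2 y) * k (Complex 2 y))" for y
  proof -
    have "summable (\<lambda>n. a (Suc n) * of_nat (Suc n) powr (- Complex 2 y))"
      by (rule summable_norm_cancel) (use summable in \<open>simp only: norm_term d_def\<close>)
    thus ?thesis
      unfolding f_def dirichlet_series_def by (intro sums_mult2 summable_sums)
  qed
  have cont_f: "continuous_on {-L..L} (f n)" for n
  proof -
    have "continuous_on {-L..L} (\<lambda>y. k (Complex 2 y))"
      unfolding k_def by (rule k.continuous_on_kernel_vertical) auto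
    moreover have "continuous_on {-L..L} (\<lambda>y. of_nat (Suc n) powr (- Complex 2 y))"
      unfolding Complex_eq powr_def by (simp del: of_nat_Suc) (intro continuous_intros)
    ultimately show ?thesis unfolding f_def by (intro continuous_on_mult continuous_on_const)
  qed
  \<comment> \<open>On this segment the kernel is bounded and the coefficients are absolutely
    summable, so the M-test permits exchanging sum and integral.\<close>
  have "uniform_limit {-L..L} (\<lambda>n y. \<Sum>i<n. f i y) (\<lambda>y. \<Sum>i. f i y) sequentially"
  proof (rule Weierstrass_m_test)
    fix n y
    have "norm (k (Complex 2 y)) \<le> C * norm t powr (-2) * exp (- \<delta> * \<bar>y\<bar>)"
      using k.strip_bound[of "Complex 2 y"] by (simp add: k_def)
    also have "\<dots> \<le> C * norm t powr (-2) * 1"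
      using C \<delta> by (intro mult_left_mono) auto
    finally show "norm (f n y) \<le> d n * (C * norm t powr (-2))"
      unfolding f_def by (subst norm_mult, subst norm_term) (auto intro!: mult_left_mono simp: d_def)
  next
    show "summable (\<lambda>n. d n * (C * norm t powr (-2)))"
      using summable unfolding d_def by (rule summable_mult2)
  qed
  then obtain I J' where "\<And>n. ((\<lambda>y. \<Sum>i<n. f i y) has_integral I n) {-L..L}"
    "((\<lambda>y. \<Sum>i. f i y) has_integral J') {-L..L}" "I \<longlonglongrightarrow> J'"
    by (rule uniform_limit_integral) (auto intro!: continuous_on_sum cont_f)
  moreover have "(\<lambda>y. \<Sum>i. f i y) = (\<lambda>y. dirichlet_series a (Complex 2 y) * k (Complex 2 y))"
    using sums_D by (simp add: sums_iff)
  moreover have "((\<lambda>y. \<Sum>i<n. f i y) has_integral (\<Sum>i<n. integral {-L..L} (f i))) {-L..L}" for n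
    by (intro has_integral_sum integrable_integral integrable_continuous_interval cont_f) auto
  ultimately have "I = (\<lambda>n. \<Sum>i<n. integral {-L..L} (f i))" "J' = J"
    unfolding J_def by (metis has_integral_unique, metis integral_unique)
  with \<open>I \<longlonglongrightarrow> J'\<close> have sums_J: "(\<lambda>n. integral {-L..L} (f n)) sums J"
    by (simp add: sums_def)

  define e where "e = (\<lambda>n. integral {-L..L} (f n) - 2 * pi * (a (Suc n) * exp (- (of_nat (Suc n) * t))))"
  have norm_e: "norm (e n) \<le> B * d n" for n
  proof -
    define t' where "t' = of_nat (Suc n) * t"
    have "t' \<noteq> 0" using t by (simp add: t'_def del: of_nat_Suc)
    moreover have "Arg t' = Arg t"
      using Arg_times_of_real[of "real (Suc n)" t] by (simp add: t'_def)
    ultimately interpret t': Gamma_kernel t' C \<delta>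
      by unfold_locales (use t C \<delta> kernel in auto)
    have "(\<lambda>y. Gamma (Complex 2 y) * t' powr (- Complex 2 y)) =
            (\<lambda>y. of_nat (Suc n) powr (- Complex 2 y) * k (Complex 2 y))"
      unfolding t'_def k_def by (subst powr_times_real_left) (auto simp: mult_ac simp del: of_nat_Suc)
    hence "integral {-L..L} (f n) = a (Suc n) * integral {-L..L} (\<lambda>y. Gamma (Complex 2 y) * t' powr (- Complex 2 y))"
      by (simp add: f_def mult.assoc)
    hence "norm (e n) = norm (a (Suc n)) * norm (integral {-L..L} (\<lambda>y. Gamma (Complex 2 y) * t' powr (- Complex 2 y)) - 2 * pi * exp (- t'))"
      unfolding e_def t'_def [symmetric] by (simp add: right_diff_distrib mult_ac flip: norm_mult)
    also have "\<dots> \<le> norm (a (Suc n)) * (2 * C / \<delta> * norm t' powr (-2) * exp (- \<delta> * L))"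
      by (intro mult_left_mono t'.Cahen_Mellin_truncated L) auto
    also have "norm t' powr (-2) = real (Suc n) powr (-2) * norm t powr (-2)"
      unfolding t'_def norm_mult norm_of_nat by (simp only: powr_mult)
    finally show ?thesis by (simp add: B_def d_def mult_ac)
  qed
  have sum_Bd: "summable (\<lambda>n. B * d n)"
    using summable unfolding d_def by (rule summable_mult)
  have sum_e: "summable e"
    by (rule summable_comparison_test[OF _ sum_Bd]) (use norm_e in auto)
  \<comment> \<open>Convergence of the exponential series comes out here as well: it is the
    difference of two convergent series.\<close>
  have "(\<lambda>n. integral {-L..L} (f n) - e n) sums (J - suminf e)"
    by (intro sums_diff sums_J summable_sums sum_e)
  hence "(\<lambda>n. 2 * pi * (a (Suc n) * exp (- (of_nat (Suc n) * t)))) sums (J - suminf e)"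
    by (simp add: e_def)
  hence "(\<lambda>n. 1 / (2 * pi) * (2 * pi * (a (Suc n) * exp (- (of_nat (Suc n) * t))))) sums (1 / (2 * pi) * (J - suminf e))"
    by (rule sums_mult)
  hence "(\<Sum>n. a (Suc n) * exp (- (of_nat (Suc n) * t))) = 1 / (2 * pi) * (J - suminf e)"
    by (simp add: sums_iff)
  hence "J - 2 * pi * (\<Sum>n. a (Suc n) * exp (- (of_nat (Suc n) * t))) = suminf e"
    by simp
  moreover have "norm (suminf e) \<le> (\<Sum>n. B * d n)"
    by (rule norm_suminf_le) (use sum_Bd norm_e in auto)
  moreover have "(\<Sum>n. B * d n) = B * suminf d"
    using summable unfolding d_def by (rule suminf_mult)
  ultimately show ?thesis by (simp add: J_def k_def B_def d_def mult_ac)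
qed

text \<open>The growth allowed to \<open>F\<close> spends half of the kernel's decay and leaves rate
  \<open>\<delta> / 2\<close>. The poles of Gamma lie to the left of \<open>\<sigma>\<close>, so the
  rectangle integral is 0; as \<open>norm t \<le> 1\<close>, the horizontal sides are worst at
  \<open>Re s = 2\<close>.\<close>

lemma norm_vertical_integral_le_of_shift:
  assumes \<delta>: "\<delta> > 0" and C: "C > 0" and M: "M \<ge> 0" and L: "L > 0" and t: "t \<noteq> 0" "norm t \<le> 1"
    and \<sigma>: "1/2 \<le> \<sigma>" "\<sigma> < 2"
    and kernel: "\<And>s. 1/2 \<le> Re s \<Longrightarrow> Re s \<le> 2 \<Longrightarrow>
           norm (Gamma s * t powr (- s)) \<le> C * norm t powr (- Re s) * exp (- \<delta> * \<bar>Im s\<bar>)"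
    and holo: "F holomorphic_on cbox (Complex \<sigma> (-L)) (Complex 2 L)"
    and bound: "\<And>s. s \<in> cbox (Complex \<sigma> (-L)) (Complex 2 L) \<Longrightarrow> norm (F s) \<le> M * exp (\<delta> / 2 * \<bar>Im s\<bar>)"
  shows "norm (integral {-L..L} (\<lambda>y. F (Complex 2 y) * (Gamma (Complex 2 y) * t powr (- Complex 2 y))))
         \<le> 4 * M * C * norm t powr (-2) * exp (- (\<delta> / 2) * L) + 4 * M * C / \<delta> * norm t powr (- \<sigma>)"
proof -
  define k where "k = (\<lambda>s. F s * (Gamma s * t powr (- s)))"
  let ?Q = "cbox (Complex \<sigma> (-L)) (Complex 2 L)"
  have Q: "s \<in> ?Q \<longleftrightarrow> \<sigma> \<le> Re s \<and> Re s \<le> 2 \<and> \<bar>Im s\<bar> \<le> L" for s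
    by (auto simp: in_cbox_complex_iff)
  have holo_k: "k holomorphic_on ?Q"
    unfolding k_def using t \<sigma>
    by (intro holomorphic_intros holo) (auto simp: Q elim!: nonpos_Ints_cases)
  have k: "norm (k s) \<le> M * C * norm t powr (- Re s) * exp (- (\<delta> / 2) * \<bar>Im s\<bar>)" if "s \<in> ?Q" for s
  proof -
    have "norm (k s) \<le> (M * exp (\<delta> / 2 * \<bar>Im s\<bar>)) * (C * norm t powr (- Re s) * exp (- \<delta> * \<bar>Im s\<bar>))"
      unfolding k_def norm_mult[of "F s"] using that \<sigma> M C
      by (intro mult_mono bound kernel) (auto simp: Q)
    also have "\<dots> = M * C * norm t powr (- Re s) * exp (\<delta> / 2 * \<bar>Im s\<bar> + - \<delta> * \<bar>Im s\<bar>)"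
      unfolding exp_add by (simp only: mult_ac)
    also have "\<delta> / 2 * \<bar>Im s\<bar> + - \<delta> * \<bar>Im s\<bar> = - (\<delta> / 2) * \<bar>Im s\<bar>" by simp
    finally show ?thesis .
  qed
  have cauchy: "contour_integral (rectpath (Complex \<sigma> (-L)) (Complex 2 L)) k = 0"
    using holo_k L \<sigma>
    by (intro contour_integral_unique Cauchy_theorem_convex_simple[of _ ?Q] path_image_rectpath_subset_cbox) auto
  have cont: "continuous_on A k" if "A \<subseteq> ?Q" for A
    using holomorphic_on_imp_continuous_on[OF holo_k] that by (rule continuous_on_subset)
  let ?V = "\<lambda>c. integral {-L..L} (\<lambda>y. k (Complex c y))"
  define H where "H = M * C * norm t powr (-2) * exp (- (\<delta> / 2) * L)"
  have "norm (\<i> * (?V 2 - ?V \<sigma>) - contour_integral (rectpath (Complex \<sigma> (-L)) (Complex 2 L)) k)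
          \<le> 2 * H * (2 - \<sigma>)"
  proof (rule norm_vertical_integral_shift_le)
    fix s assume s: "\<sigma> \<le> Re s" "Re s \<le> 2" "\<bar>Im s\<bar> = L"
    have "norm t powr (- Re s) \<le> norm t powr (-2)"
      using t s by (intro powr_mono') auto
    hence "M * C * norm t powr (- Re s) * exp (- (\<delta> / 2) * \<bar>Im s\<bar>) \<le> H"
      unfolding H_def s(3) using M C by (intro mult_right_mono mult_left_mono) auto
    thus "norm (k s) \<le> H" using k[of s] s by (auto simp: Q)
  qed (use \<sigma> L M C cont in \<open>auto simp: H_def\<close>)
  also have "\<dots> \<le> 2 * H * 2"
    using \<sigma> M C by (intro mult_left_mono) (auto simp: H_def)
  finally have 1: "norm (?V 2 - ?V \<sigma>) \<le> 4 * H" unfolding cauchy by (simp add: norm_mult)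
  have "norm (?V \<sigma> - integral {-0..0} (\<lambda>y. k (Complex \<sigma> y))) \<le> 2 * (M * C * norm t powr (- \<sigma>)) / (\<delta> / 2) * exp (- (\<delta> / 2) * 0)"
  proof (rule norm_integral_tails_le)
    show "continuous_on {-L..L} (\<lambda>y. k (Complex \<sigma> y))"
    proof (rule continuous_on_compose2[OF cont[OF order_refl]])
      show "continuous_on {-L..L} (Complex \<sigma>)" unfolding Complex_eq by (intro continuous_intros)
    qed (use \<sigma> in \<open>auto simp: in_cbox_complex_iff\<close>)
    show "norm (k (Complex \<sigma> y)) \<le> M * C * norm t powr (- \<sigma>) * exp (- (\<delta> / 2) * \<bar>y\<bar>)" if "\<bar>y\<bar> \<le> L" for y
      using k[of "Complex \<sigma> y"] that \<sigma> by (simp add: Q)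
  qed (use \<delta> L M C in auto)
  hence 2: "norm (?V \<sigma>) \<le> 4 * M * C / \<delta> * norm t powr (- \<sigma>)" by (simp add: mult_ac)
  have "norm (?V 2) \<le> norm (?V 2 - ?V \<sigma>) + norm (?V \<sigma>)"
    using norm_triangle_ineq[of "?V 2 - ?V \<sigma>" "?V \<sigma>"] by simp
  also have "\<dots> \<le> 4 * H + 4 * M * C / \<delta> * norm t powr (- \<sigma>)"
    using 1 2 by (rule add_mono)
  finally show ?thesis by (simp add: k_def H_def mult_ac)
qed

section \<open>Uniform bounds for the continuation on rectangles inside \<open>Omega\<close>\<close>

lemma powr_le_exp:
  fixes \<nu> d u :: real
  assumes "\<nu> > 0" "d > 0" "u \<ge> 0"
  shows "u powr \<nu> \<le> (1 + \<nu> / d) powr \<nu> * exp (d * u)"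
proof -
  have "u \<le> (1 + 1 / (d / \<nu>)) * exp (d / \<nu> * u)"
    using one_plus_le_exp[of "d / \<nu>" u] assms by simp
  hence "u powr \<nu> \<le> ((1 + \<nu> / d) * exp (d / \<nu> * u)) powr \<nu>"
    using assms by (intro powr_mono2) auto
  also have "\<dots> = (1 + \<nu> / d) powr \<nu> * exp (d / \<nu> * u) powr \<nu>"
    by (simp only: powr_mult)
  also have "exp (d / \<nu> * u) powr \<nu> = exp (d * u)"
    using assms by (simp add: powr_def)
  finally show ?thesis .
qed

text \<open>One constant \<open>M\<close> serves all heights \<open>L\<close>. Points with
  \<open>\<bar>Im s\<bar> \<le> w0\<close> lie in the fixed compact rectangle of height
  \<open>w0\<close>, as its left edge is the furthest left by monotonicity of \<open>g\<close>; at
  larger height the polynomial growth is absorbed by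
  \<open>exp (d * \<bar>Im s\<bar>)\<close>.\<close>

lemma Omega_boxes:
  assumes params: "\<alpha> > 0" "\<beta> > 0" "b > 0" "w > exp 1" "\<nu> > 0" and "d > 0"
    and ana: "F analytic_on Omega \<alpha> \<beta> b w"
    and growth: "\<forall>s\<in>Omega \<alpha> \<beta> b w. \<bar>Im s\<bar> \<ge> T \<longrightarrow> norm (F s) \<le> C * \<bar>Im s\<bar> powr \<nu>"
  shows "\<exists>M\<ge>0. \<exists>w0>0. \<forall>L\<ge>w0. 1/2 \<le> gfun \<alpha> \<beta> b w L \<and> gfun \<alpha> \<beta> b w L < 2 \<and>
           (\<forall>s\<in>cbox (Complex (gfun \<alpha> \<beta> b w L) (-L)) (Complex 2 L).
              s \<in> Omega \<alpha> \<beta> b w \<and> norm (F s) \<le> M * exp (d * \<bar>Im s\<bar>))"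
proof -
  let ?g = "gfun \<alpha> \<beta> b w"
  let ?Q = "\<lambda>L. cbox (Complex (?g L) (-L)) (Complex 2 L)"
  note mono = gfun_mono[OF params(1-4)]
  have Omega: "s \<in> Omega \<alpha> \<beta> b w" if "s \<in> ?Q L" "L \<ge> 0" for s L
    using mono[of "Im s" L] that by (auto simp: Omega_def in_cbox_complex_iff abs_le_iff)
  have "eventually (\<lambda>L. ?g L > 1/2) at_top" "eventually (\<lambda>L. ?g L < 2) at_top"
    by (rule order_tendstoD[OF gfun_tendsto_1[OF params(1,2)]]; simp)+
  hence "eventually (\<lambda>L. ?g L > 1/2 \<and> ?g L < 2 \<and> L \<ge> max 1 T) at_top"
    using eventually_ge_at_top[of "max 1 T"] by eventually_elim auto
  then obtain w0 where w0: "\<And>L. L \<ge> w0 \<Longrightarrow> ?g L > 1/2 \<and> ?g L < 2 \<and> L \<ge> max 1 T"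
    unfolding eventually_at_top_linorder by blast
  have w0': "w0 \<ge> 1" "w0 \<ge> T" using w0[of w0] by auto
  have "continuous_on (?Q w0) F"
    using ana Omega[of _ w0] w0'
    by (intro holomorphic_on_imp_continuous_on analytic_imp_holomorphic analytic_on_subset[OF ana]) auto
  hence "bounded (F ` ?Q w0)"
    by (intro compact_imp_bounded compact_continuous_image) auto
  then obtain M0 where M0: "\<And>s. s \<in> ?Q w0 \<Longrightarrow> norm (F s) \<le> M0"
    by (auto simp: bounded_iff)
  define M where "M = max \<bar>M0\<bar> (\<bar>C\<bar> * (1 + \<nu> / d) powr \<nu>)"
  have "M \<ge> 0" by (simp add: M_def)
  have "norm (F s) \<le> M * exp (d * \<bar>Im s\<bar>)" if s: "s \<in> ?Q L" and L: "L \<ge> w0" for s L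
  proof (cases "\<bar>Im s\<bar> \<le> w0")
    case True
    have "?g w0 \<le> ?g L" using L w0' by (intro mono) auto
    hence "s \<in> ?Q w0" using s True by (auto simp: in_cbox_complex_iff)
    hence "norm (F s) \<le> M * 1" using M0[of s] by (simp add: M_def)
    also have "\<dots> \<le> M * exp (d * \<bar>Im s\<bar>)"
      using \<open>M \<ge> 0\<close> \<open>d > 0\<close> by (intro mult_left_mono) auto
    finally show ?thesis .
  next
    case False
    have "norm (F s) \<le> C * \<bar>Im s\<bar> powr \<nu>"
      using False w0' L growth Omega[OF s] by simp
    also have "\<dots> \<le> \<bar>C\<bar> * ((1 + \<nu> / d) powr \<nu> * exp (d * \<bar>Im s\<bar>))"
      using params \<open>d > 0\<close> by (intro mult_mono powr_le_exp) auto
    also have "\<dots> \<le> M * exp (d * \<bar>Im s\<bar>)"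
      unfolding mult.assoc [symmetric] by (intro mult_right_mono) (auto simp: M_def)
    finally show ?thesis .
  qed
  moreover have "s \<in> Omega \<alpha> \<beta> b w" if "s \<in> ?Q L" "L \<ge> w0" for s L
    using Omega[of s L] that w0' by simp
  moreover have "1/2 \<le> ?g L" "?g L < 2" if "L \<ge> w0" for L
    using w0[OF that] by auto
  moreover have "w0 > 0" using w0' by simp
  ultimately show ?thesis using \<open>M \<ge> 0\<close> by blast
qed

section \<open>Choice of the constants and assembly of the estimate\<close>

theorem theorem1:
  fixes a :: "nat \<Rightarrow> complex" and \<alpha> \<beta> b w \<nu> :: real
  assumes params: "\<alpha> > 0" "\<beta> > 0" "b > 0" "w > exp 1" "\<nu> > 0"
    and abs_conv: "\<And>s. Re s > 1 \<Longrightarrow>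
                     summable (\<lambda>n. norm (a (Suc n) * of_nat (Suc n) powr (- s)))"
    and cont: "\<exists>F. F analytic_on Omega \<alpha> \<beta> b w
               \<and> (\<forall>s. Re s > 1 \<longrightarrow> F s = dirichlet_series a s)
               \<and> (\<exists>C T. \<forall>s\<in>Omega \<alpha> \<beta> b w. \<bar>Im s\<bar> \<ge> T \<longrightarrow>
                      norm (F s) \<le> C * \<bar>Im s\<bar> powr \<nu>)"
  shows "\<forall>\<epsilon>>0. \<forall>\<theta>>0. \<exists>C. eventually (\<lambda>z.
            norm (power_ser a z) \<le>
              C * (1 / norm (- Ln z)) *
              exp (- ((b - \<epsilon>) * ln (1 / norm (- Ln z)) /
                      ((ln (ln (1 / norm (- Ln z)))) powr \<alpha> *
                       (ln (ln (ln (1 / norm (- Ln z))))) powr \<beta>))))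
          (at 1 within sector \<theta>)"
proof (intro allI impI)
  fix \<epsilon> \<theta> :: real
  assume "\<epsilon> > 0" "\<theta> > 0"
  obtain F C0 T where ana: "F analytic_on Omega \<alpha> \<beta> b w"
    and F_eq: "\<And>s. Re s > 1 \<Longrightarrow> F s = dirichlet_series a s"
    and growth: "\<forall>s\<in>Omega \<alpha> \<beta> b w. \<bar>Im s\<bar> \<ge> T \<longrightarrow> norm (F s) \<le> C0 * \<bar>Im s\<bar> powr \<nu>"
    using cont by blast
  let ?g = "gfun \<alpha> \<beta> b w"
  \<comment> \<open>Then the eventual bound \<open>pi / 2 - \<theta> / 2\<close> on
    \<open>\<bar>Arg t\<bar>\<close> is the \<open>pi / 2 - 2 * \<delta>\<close> required by the
    kernel bound.\<close>
  define \<delta> where "\<delta> = \<theta> / 4"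
  have "\<delta> > 0" using \<open>\<theta> > 0\<close> by (simp add: \<delta>_def)
  obtain C where "C > 0" and kernel: "\<And>s t. 1/2 \<le> Re s \<Longrightarrow> Re s \<le> 2 \<Longrightarrow> \<bar>Arg t\<bar> \<le> pi / 2 - 2 * \<delta> \<Longrightarrow>
           norm (Gamma s * t powr (- s)) \<le> C * norm t powr (- Re s) * exp (- \<delta> * \<bar>Im s\<bar>)"
    using norm_Gamma_kernel_bound[OF \<open>\<delta> > 0\<close>] by blast
  have "\<delta> / 2 > 0" using \<open>\<delta> > 0\<close> by simp
  from Omega_boxes[OF params this ana growth] obtain M w0 where "M \<ge> 0" "w0 > 0"
    and w0: "\<forall>L\<ge>w0. 1/2 \<le> ?g L \<and> ?g L < 2 \<and>
           (\<forall>s\<in>cbox (Complex (?g L) (-L)) (Complex 2 L).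
              s \<in> Omega \<alpha> \<beta> b w \<and> norm (F s) \<le> M * exp (\<delta> / 2 * \<bar>Im s\<bar>))"
    by blast
  have g_bounds: "1/2 \<le> ?g L" "?g L < 2" if "L \<ge> w0" for L
    using w0 that by simp_all
  have boxes: "s \<in> Omega \<alpha> \<beta> b w" "norm (F s) \<le> M * exp (\<delta> / 2 * \<bar>Im s\<bar>)"
    if "L \<ge> w0" "s \<in> cbox (Complex (?g L) (-L)) (Complex 2 L)" for L s
    using w0 that by simp_all
  have summable: "summable (\<lambda>n. norm (a (Suc n)) * real (Suc n) powr (-2))"
    using abs_conv[of 2] by (simp add: norm_mult norm_powr_real_powr del: of_nat_Suc)
  define A where "A = (\<Sum>n. norm (a (Suc n)) * real (Suc n) powr (-2))"
  have "A \<ge> 0" unfolding A_def by (intro suminf_nonneg summable) auto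
  \<comment> \<open>For \<open>L = K * ln (1 / norm t)\<close> this choice gives
    \<open>norm t powr (-2) * exp (- (\<delta> / 2) * L) = 1\<close>, so truncation and horizontal
    sides contribute only constants.\<close>
  define K where "K = 4 / \<delta>"
  have "K > 0" using \<open>\<delta> > 0\<close> by (simp add: K_def)
  \<comment> \<open>\<open>K1\<close> collects these bounded contributions; \<open>K2\<close> is the
    constant on the shifted line \<open>Re s = g(L)\<close>.\<close>
  define K1 where "K1 = 2 * C / \<delta> * A + 4 * M * C"
  define K2 where "K2 = 4 * M * C / \<delta>"
  have "K1 \<ge> 0" "K2 \<ge> 0"
    using \<open>C > 0\<close> \<open>\<delta> > 0\<close> \<open>A \<ge> 0\<close> \<open>M \<ge> 0\<close> by (auto simp: K1_def K2_def)
  let ?X = "\<lambda>z. ln (1 / norm (- Ln z))"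
  let ?E = "\<lambda>X. X - (b - \<epsilon>) * X / (ln X powr \<alpha> * ln (ln X) powr \<beta>)"
  have main: "norm (power_ser a z) \<le> K1 + K2 * exp (?X z * ?g (K * ?X z))"
    if z: "z \<noteq> 0" "z \<noteq> 1" "\<bar>Arg (- Ln z)\<bar> \<le> pi / 2 - \<theta> / 2" "?X z \<ge> 0" "K * ?X z \<ge> w0" for z
  proof -
    define t where "t = - Ln z"
    define X L where "X = ?X z" and "L = K * X"
    have "t \<noteq> 0" using z by (metis exp_Ln exp_zero neg_equal_0_iff_equal t_def)
    hence t_exp: "norm t = exp (- X)" by (simp add: X_def t_def ln_div)
    have t_powr: "norm t powr (- p) = exp (X * p)" for p
      by (simp add: t_exp powr_def mult.commute)
    have "norm t \<le> 1" using z by (simp add: t_exp X_def)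
    have "L \<ge> w0" using z by (simp add: L_def X_def)
    have "L > 0" using \<open>L \<ge> w0\<close> \<open>w0 > 0\<close> by simp
    have arg: "\<bar>Arg t\<bar> \<le> pi / 2 - 2 * \<delta>" using z by (simp add: t_def \<delta>_def)
    have decay: "norm t powr (-2) * exp (- (\<delta> / 2) * L) = 1"
      using \<open>\<delta> > 0\<close> unfolding t_powr L_def K_def by (simp flip: exp_add)
    have pow: "z ^ n = exp (- (of_nat n * t))" for n
      using z exp_of_nat_mult[of n "Ln z"] by (simp add: t_def)
    have P: "power_ser a z = (\<Sum>n. a (Suc n) * exp (- (of_nat (Suc n) * t)))"
      unfolding power_ser_def pow ..
    let ?k = "\<lambda>y. Gamma (Complex 2 y) * t powr (- Complex 2 y)"
    have "norm (integral {-L..L} (\<lambda>y. dirichlet_series a (Complex 2 y) * ?k y) - 2 * pi * power_ser a z)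
            \<le> 2 * C / \<delta> * A * norm t powr (-2) * exp (- \<delta> * L)"
      unfolding P A_def
      by (rule norm_Dirichlet_vertical_integral_minus_exp_series_le
            [OF \<open>\<delta> > 0\<close> \<open>C > 0\<close> less_imp_le[OF \<open>L > 0\<close>] \<open>t \<noteq> 0\<close> arg kernel summable])
    \<comment> \<open>Half of the decay is given away so that the cancellation in
      \<open>decay\<close> applies verbatim.\<close>
    also have "\<dots> \<le> 2 * C / \<delta> * A * norm t powr (-2) * exp (- (\<delta> / 2) * L)"
      using \<open>\<delta> > 0\<close> \<open>C > 0\<close> \<open>A \<ge> 0\<close> \<open>L > 0\<close> by (intro mult_left_mono) auto
    also have "\<dots> = 2 * C / \<delta> * A"
      using decay by (simp only: mult.assoc mult_1_right)
    finally have 1: "norm (integral {-L..L} (\<lambda>y. dirichlet_series a (Complex 2 y) * ?k y) - 2 * pi * power_ser a z)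
            \<le> 2 * C / \<delta> * A" .
    have "norm (integral {-L..L} (\<lambda>y. F (Complex 2 y) * ?k y))
         \<le> 4 * M * C * norm t powr (-2) * exp (- (\<delta> / 2) * L) + 4 * M * C / \<delta> * norm t powr (- ?g L)"
    proof (rule norm_vertical_integral_le_of_shift[OF \<open>\<delta> > 0\<close> \<open>C > 0\<close> \<open>M \<ge> 0\<close> \<open>L > 0\<close> \<open>t \<noteq> 0\<close> \<open>norm t \<le> 1\<close>
             _ _ kernel[OF _ _ arg]])
      show "F holomorphic_on cbox (Complex (?g L) (- L)) (Complex 2 L)"
        using boxes[OF \<open>L \<ge> w0\<close>] by (intro analytic_imp_holomorphic analytic_on_subset[OF ana]) auto
    qed (use g_bounds[OF \<open>L \<ge> w0\<close>] boxes[OF \<open>L \<ge> w0\<close>] in simp_all)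
    also have "\<dots> = 4 * M * C + K2 * exp (X * ?g L)"
      using decay by (simp only: t_powr K2_def mult.assoc mult_1_right)
    also have "(\<lambda>y. F (Complex 2 y) * ?k y) = (\<lambda>y. dirichlet_series a (Complex 2 y) * ?k y)"
      by (simp add: F_eq)
    finally have 2: "norm (integral {-L..L} (\<lambda>y. dirichlet_series a (Complex 2 y) * ?k y))
                       \<le> 4 * M * C + K2 * exp (X * ?g L)" .
    have "norm (2 * pi * power_ser a z) \<le> K1 + K2 * exp (X * ?g L)"
      using norm_triangle_sub[of "2 * pi * power_ser a z" "integral {-L..L} (\<lambda>y. dirichlet_series a (Complex 2 y) * ?k y)"]
        1 2 by (simp add: norm_minus_commute K1_def)
    moreover have "1 * norm (power_ser a z) \<le> 2 * pi * norm (power_ser a z)"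
      using pi_ge_two by (intro mult_right_mono) auto
    ultimately show ?thesis by (simp add: norm_mult X_def L_def)
  qed
  have X_lim: "filterlim ?X at_top (at 1 within sector \<theta>)"
    by (rule filterlim_ln_inverse_norm_Ln)
  have "filterlim (\<lambda>X. K * X) at_top at_top" using \<open>K > 0\<close> by real_asymp
  hence "eventually (\<lambda>X. K * X \<ge> w0) at_top" unfolding filterlim_at_top by blast
  hence "eventually (\<lambda>X. X \<ge> 0 \<and> K * X \<ge> w0 \<and> X * ?g (K * X) \<le> ?E X \<and> 0 \<le> ?E X) at_top"
    using eventually_ge_at_top[of 0] eventually_exponent_nonneg[OF params(1,2), of "b - \<epsilon>"]
      eventually_gfun_scaled_le[OF params(1-3) \<open>K > 0\<close> \<open>\<epsilon> > 0\<close>, of w]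
    by eventually_elim auto
  hence "eventually (\<lambda>z. ?X z \<ge> 0 \<and> K * ?X z \<ge> w0 \<and> ?X z * ?g (K * ?X z) \<le> ?E (?X z) \<and> 0 \<le> ?E (?X z))
           (at 1 within sector \<theta>)"
    using X_lim by (rule eventually_compose_filterlim)
  moreover have "eventually (\<lambda>z. z \<noteq> 0) (at 1 within sector \<theta>)"
    using eventually_neq_at_within[of 0 "1::complex"] by simp
  moreover have "eventually (\<lambda>z. z \<noteq> 1) (at 1 within sector \<theta>)"
    by (simp add: eventually_at_filter)
  moreover note eventually_Arg_uminus_Ln_sector[OF \<open>\<theta> > 0\<close>]
  ultimately have "eventually (\<lambda>z. norm (power_ser a z) \<le>
              (K1 + K2) * (1 / norm (- Ln z)) *
              exp (- ((b - \<epsilon>) * ln (1 / norm (- Ln z)) /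
                      ((ln (ln (1 / norm (- Ln z)))) powr \<alpha> *
                       (ln (ln (ln (1 / norm (- Ln z))))) powr \<beta>)))) (at 1 within sector \<theta>)"
  proof eventually_elim
    case (elim z)
    have "norm (power_ser a z) \<le> K1 * 1 + K2 * exp (?X z * ?g (K * ?X z))"
      using main[of z] elim by simp
    \<comment> \<open>The constant \<open>K1\<close> is absorbed because the exponent
      \<open>?E\<close> is eventually nonnegative.\<close>
    also have "\<dots> \<le> K1 * exp (?E (?X z)) + K2 * exp (?E (?X z))"
      using elim \<open>K1 \<ge> 0\<close> \<open>K2 \<ge> 0\<close> by (intro add_mono mult_left_mono) auto
    also have "\<dots> = (K1 + K2) * (exp (?X z) * exp (- ((b - \<epsilon>) * ?X z / (ln (?X z) powr \<alpha> * ln (ln (?X z)) powr \<beta>))))"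
      unfolding exp_add [symmetric] by (simp add: distrib_right)
    also have "exp (?X z) = 1 / norm (- Ln z)"
    proof -
      have "Ln z \<noteq> 0" using elim by (metis exp_Ln exp_zero)
      thus ?thesis by simp
    qed
    finally show ?case by (simp only: mult.assoc)
  qed
  thus "\<exists>C. eventually (\<lambda>z. norm (power_ser a z) \<le>
              C * (1 / norm (- Ln z)) *
              exp (- ((b - \<epsilon>) * ln (1 / norm (- Ln z)) /
                      ((ln (ln (1 / norm (- Ln z)))) powr \<alpha> *
                       (ln (ln (ln (1 / norm (- Ln z))))) powr \<beta>)))) (at 1 within sector \<theta>)"
    by blast
qed

end
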